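(* There is a universal constant $C>0$ such that the following holds. Let $U$ be a unitary and $\Pi,\widetilde\Pi$ orthogonal projectors on a finite-dimensional Hilbert space, let $\gamma>1$ and $\delta,\varepsilon\in(0,\frac12)$, and let $\widetilde\Pi U\Pi=\sum_i\varsigma_i|w_i\rangle\langle v_i|$ be a singular value decomposition. Then there exist an odd $m\le C\frac{\gamma}{\delta}\log(\gamma/\varepsilon)$ and $\Phi\in\mathbb{R}^m$ such that $$\left(\langle+|\otimes\widetilde\Pi_{\le\frac{1-\delta}{\gamma}}\right)\left(|0\rangle\langle0|\otimes U_\Phi+|1\rangle\langle1|\otimes U_{-\Phi}\right)\left(|+\rangle\otimes\Pi_{\le\frac{1-\delta}{\gamma}}\right)=\sum_{i:\varsigma_i\le\frac{1-\delta}{\gamma}}\tilde\varsigma_i|w_i\rangle\langle v_i|,$$ where $\tilde\varsigma_i=0$ if $\varsigma_i=0$ and $\left|\frac{\tilde\varsigma_i}{\gamma\varsigma_i}-1\right|\le\varepsilon$ if $\varsigma_i>0$.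
   Context: Singular value decomposition: $(|v_i\rangle)_{i\le d}$ orthonormal basis of $\mathrm{img}\,\Pi$, $(|w_i\rangle)_{i\le\tilde d}$ orthonormal basis of $\mathrm{img}\,\widetilde\Pi$, $\varsigma_i\ge0$ for $i\le\min(d,\tilde d)$, and $\varsigma_i:=0$ for larger indices. Threshold projectors: $\Pi_{\le t}$ is the orthogonal projector onto $\mathrm{span}\{|v_i\rangle:\varsigma_i\le t\}$ and $\widetilde\Pi_{\le t}$ onto $\mathrm{span}\{|w_i\rangle:\varsigma_i\le t\}$. $|+\rangle=(|0\rangle+|1\rangle)/\sqrt2$ on an extra qubit. For odd $m$, $U_\Phi:=e^{i\phi_1(2\widetilde\Pi-I)}U\prod_{j=1}^{(m-1)/2}\left(e^{i\phi_{2j}(2\Pi-I)}U^\dagger e^{i\phi_{2j+1}(2\widetilde\Pi-I)}U\right)$ (left to right). *)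

theory Defs
  imports "Jordan_Normal_Form.Schur_Decomposition"
begin

definition unitary_mat :: "nat \<Rightarrow> complex mat \<Rightarrow> bool" where
  "unitary_mat n U \<longleftrightarrow> U \<in> carrier_mat n n \<and>
     mat_adjoint U * U = 1\<^sub>m n \<and> U * mat_adjoint U = 1\<^sub>m n"

definition orth_proj :: "nat \<Rightarrow> complex mat \<Rightarrow> bool" where
  "orth_proj n P \<longleftrightarrow> P \<in> carrier_mat n n \<and> P * P = P \<and> mat_adjoint P = P"

definition mat_img :: "nat \<Rightarrow> complex mat \<Rightarrow> complex vec set" where
  "mat_img n P = {P *\<^sub>v x | x. x \<in> carrier_vec n}"

definition lin_span :: "nat \<Rightarrow> (nat \<Rightarrow> complex vec) \<Rightarrow> nat set \<Rightarrow> complex vec set" where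
  "lin_span n f I = {vec n (\<lambda>a. \<Sum>i\<in>I. c i * (f i $ a)) | c. True}"

definition proj_onto :: "nat \<Rightarrow> complex vec set \<Rightarrow> complex mat" where
  "proj_onto n S = (THE P. orth_proj n P \<and> mat_img n P = S)"

definition orthonormal_family :: "nat \<Rightarrow> (nat \<Rightarrow> complex vec) \<Rightarrow> nat \<Rightarrow> bool" where
  "orthonormal_family n f k \<longleftrightarrow> (\<forall>i<k. f i \<in> carrier_vec n) \<and>
     (\<forall>i<k. \<forall>j<k. f i \<bullet>c f j = (if i = j then 1 else 0))"

definition onb_of_img :: "nat \<Rightarrow> complex mat \<Rightarrow> (nat \<Rightarrow> complex vec) \<Rightarrow> nat \<Rightarrow> bool" where
  "onb_of_img n P f k \<longleftrightarrow> orthonormal_family n f k \<and> lin_span n f {..<k} = mat_img n P"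

definition ket_bra :: "complex vec \<Rightarrow> complex vec \<Rightarrow> complex mat" where
  "ket_bra w v = mat (dim_vec w) (dim_vec v) (\<lambda>(a,b). w $ a * cnj (v $ b))"

definition mat_sum :: "nat \<Rightarrow> (nat \<Rightarrow> complex mat) \<Rightarrow> nat set \<Rightarrow> complex mat" where
  "mat_sum n f I = mat n n (\<lambda>(a,b). \<Sum>i\<in>I. f i $$ (a,b))"

definition mat_exp :: "complex mat \<Rightarrow> complex mat" where
  "mat_exp A = mat (dim_row A) (dim_col A) (\<lambda>(a,b). \<Sum>k. (A ^\<^sub>m k) $$ (a,b) / of_nat (fact k))"

definition refl_exp :: "nat \<Rightarrow> complex mat \<Rightarrow> real \<Rightarrow> complex mat" where
  "refl_exp n P \<phi> = mat_exp ((\<i> * complex_of_real \<phi>) \<cdot>\<^sub>m (2 \<cdot>\<^sub>m P - 1\<^sub>m n))"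

definition mat_prod_list :: "nat \<Rightarrow> complex mat list \<Rightarrow> complex mat" where
  "mat_prod_list n Ms = foldr (*) Ms (1\<^sub>m n)"

text \<open>U_Phi for odd m = length Phi, phases phi_1..phi_m stored as Phi!0 .. Phi!(m-1):
  U_Phi = e^{i phi_1 (2 Pt - I)} U prod_{j=1}^{(m-1)/2}
          (e^{i phi_{2j} (2 P - I)} U^dagger e^{i phi_{2j+1} (2 Pt - I)} U).\<close>
definition U_Phi :: "nat \<Rightarrow> complex mat \<Rightarrow> complex mat \<Rightarrow> complex mat \<Rightarrow> real list \<Rightarrow> complex mat" where
  "U_Phi n U P Pt \<Phi> =
     refl_exp n Pt (\<Phi> ! 0) * U *
     mat_prod_list n (map (\<lambda>j. refl_exp n P (\<Phi> ! (2*j - 1)) * mat_adjoint U *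
                               refl_exp n Pt (\<Phi> ! (2*j)) * U)
                          [1..<(length \<Phi> - 1) div 2 + 1])"

definition kron :: "complex mat \<Rightarrow> complex mat \<Rightarrow> complex mat" where
  "kron A B = mat (dim_row A * dim_row B) (dim_col A * dim_col B)
     (\<lambda>(i,j). A $$ (i div dim_row B, j div dim_col B) * B $$ (i mod dim_row B, j mod dim_col B))"

text \<open>Qubit kets as 2 x 1 matrices; bras are their adjoints.\<close>
definition ket0 :: "complex mat" where "ket0 = mat_of_cols_list 2 [[1, 0]]"
definition ket1 :: "complex mat" where "ket1 = mat_of_cols_list 2 [[0, 1]]"
definition ket_plus :: "complex mat" where
  "ket_plus = mat_of_cols_list 2 [[1 / complex_of_real (sqrt 2), 1 / complex_of_real (sqrt 2)]]"

end

theory Submission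
  imports Defs "HOL-Computational_Algebra.Fundamental_Theorem_Algebra"
begin

text \<open>
  On the span of a pair of singular vectors and their complements, \<open>U\<close> acts as the reflection
  \<open>R(x) = [[x, s], [s, -x]]\<close> with \<open>x = \<varsigma>\<^sub>i\<close> and \<open>s = sqrt (1 - x\<^sup>2)\<close>, so \<open>U\<^sub>\<Phi>\<close> acts as a product of
  such reflections and diagonal phases. Averaging over \<open>\<Phi>\<close> and \<open>-\<Phi>\<close> leaves the real part of the
  upper left entry, and every odd real polynomial \<open>p\<close> of degree at most \<open>m\<close> with \<open>|p| < 1\<close> on
  \<open>[-1, 1]\<close> arises in this way: by the Markov-Lukacs theorem \<open>1 - p\<^sup>2 = C\<^sup>2 + (1 - x\<^sup>2) D\<^sup>2\<close>, and
  the unitary matrix with first column \<open>(p + \<i> C, s D)\<close> can be peeled off one phase at a time, because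
  its top coefficients have equal modulus.

  It remains to approximate \<open>\<gamma> x\<close> by such a \<open>p\<close>. One takes \<open>p(x) = (1 - \<epsilon>/4) \<gamma> x \<Sigma>(x) \<Sigma>(-x)\<close>, where
  the decreasing step \<open>\<Sigma>\<close> from 1 to 0 around \<open>(1 - \<delta>/2)/\<gamma>\<close> is a normalised integral of
  \<open>(T\<^sub>M(u) / u)\<^sup>2\<^sup>N\<close> for the Chebyshev polynomial of an odd degree \<open>M\<close> of order \<open>\<gamma>/\<delta>\<close> and \<open>N\<close>
  of order \<open>log (\<gamma>/\<epsilon>)\<close>. The strict bound \<open>|p| < 1\<close> keeps the roots of \<open>1 - p\<^sup>2\<close> off \<open>[-1, 1]\<close>.
\<close>

section \<open>Polynomials of definite parity\<close>

text \<open>Degree at most \<open>N\<close> together with the parity of \<open>N\<close>, in one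
  predicate. Phrasing it through nonzero coefficients admits the zero polynomial for every
  \<open>N\<close>, and \<open>even (N + i)\<close> avoids subtraction.\<close>

definition graded :: "nat \<Rightarrow> 'a::comm_ring_1 poly \<Rightarrow> bool" where
  "graded N p \<longleftrightarrow> (\<forall>i. coeff p i \<noteq> 0 \<longrightarrow> i \<le> N \<and> even (N + i))"

lemma gradedD: "graded N p \<Longrightarrow> i > N \<or> odd (N + i) \<Longrightarrow> coeff p i = 0"
  unfolding graded_def by force

lemma graded_degree: "graded N p \<Longrightarrow> degree p \<le> N"
  by (metis degree_le gradedD)

lemma graded_add: "graded N p \<Longrightarrow> graded N q \<Longrightarrow> graded N (p + q)"
  unfolding graded_def by (metis add_0 coeff_add)

lemma graded_diff: "graded N p \<Longrightarrow> graded N q \<Longrightarrow> graded N (p - q)"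
  unfolding graded_def by (metis coeff_diff diff_self)

lemma graded_smult: "graded N p \<Longrightarrow> graded N (smult c p)"
  unfolding graded_def by (metis coeff_smult mult_zero_right)

lemma graded_mono: "graded N p \<Longrightarrow> N \<le> M \<Longrightarrow> even (N + M) \<Longrightarrow> graded M p"
  unfolding graded_def by (metis (full_types) even_add order.trans)

lemma graded_mult:
  fixes p q :: "'a::comm_ring_1 poly"
  assumes "graded N p" "graded M q"
  shows "graded (N + M) (p * q)"
  unfolding graded_def
proof (intro allI impI)
  fix i assume "coeff (p * q) i \<noteq> 0"
  then have "(\<Sum>k\<le>i. coeff p k * coeff q (i - k)) \<noteq> 0" by (simp add: coeff_mult)
  then obtain k where k: "k \<le> i" "coeff p k * coeff q (i - k) \<noteq> 0"
    by (metis (no_types, lifting) atMost_iff sum.neutral)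
  then have "coeff p k \<noteq> 0" "coeff q (i - k) \<noteq> 0" by auto
  with assms have *: "k \<le> N" "even (N + k)" "i - k \<le> M" "even (M + (i - k))"
    unfolding graded_def by auto
  have "i = k + (i - k)" using k by simp
  with * show "i \<le> N + M \<and> even (N + M + i)"
    by (metis (no_types, opaque_lifting) add_mono even_add)
qed

text \<open>For degree bounds instead of exact degrees, so that top coefficients may vanish: in the
  convolution only \<open>k = N\<close> survives.\<close>

lemma coeff_mult_top:
  fixes p q :: "'a::comm_ring_1 poly"
  assumes "degree p \<le> N" "degree q \<le> M"
  shows "coeff (p * q) (N + M) = coeff p N * coeff q M"
proof -
  have "coeff (p * q) (N + M) = (\<Sum>k\<le>N + M. if k = N then coeff p N * coeff q M else 0)"
    unfolding coeff_mult
  proof (rule sum.cong)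
    fix k assume k: "k \<in> {..N + M}"
    show "coeff p k * coeff q (N + M - k) = (if k = N then coeff p N * coeff q M else 0)"
    proof (cases "k \<le> N")
      case True
      have "N + M - k > M" if "k \<noteq> N" using that True by simp
      then show ?thesis using assms by (auto simp: coeff_eq_0)
    next
      case False then show ?thesis using assms by (simp add: coeff_eq_0)
    qed
  qed simp
  then show ?thesis by simp
qed

lemma graded_pCons_0: "graded (Suc N) (pCons 0 p) \<longleftrightarrow> graded N p"
  unfolding graded_def
proof safe
  fix i assume *: "\<forall>i. coeff (pCons 0 p) i \<noteq> 0 \<longrightarrow> i \<le> Suc N \<and> even (Suc N + i)" "coeff p i \<noteq> 0"
  then show "i \<le> N" "even (N + i)" using spec[OF *(1), of "Suc i"] by auto
next
  fix i assume *: "\<forall>i. coeff p i \<noteq> 0 \<longrightarrow> i \<le> N \<and> even (N + i)" "coeff (pCons 0 p) i \<noteq> 0"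
  then show "i \<le> Suc N" "even (Suc N + i)" by (cases i; auto)+
qed

section \<open>Positive polynomials on the unit interval\<close>

text \<open>\<open>graded N (pCons 0 D)\<close> expresses that \<open>D\<close> has order
  \<open>N - 1\<close>; it avoids truncated subtraction and forces \<open>D = 0\<close> when
  \<open>N = 0\<close>.\<close>

definition sos_form :: "nat \<Rightarrow> real poly \<Rightarrow> real poly \<Rightarrow> bool" where
  "sos_form N C D \<longleftrightarrow> graded N C \<and> graded N (pCons 0 D)"

text \<open>With \<open>x = cos \<theta>\<close> this is multiplication of the trigonometric polynomials
  \<open>C(cos \<theta>) + \<i> sin \<theta> D(cos \<theta>)\<close>.\<close>

lemma sos_form_mult:
  assumes "sos_form N C D" "sos_form M E F"
  defines "A \<equiv> C * E - [:1, 0, -1:] * (D * F)" and "B \<equiv> C * F + E * D"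
  shows "sos_form (N + M) A B"
    and "(poly A x)\<^sup>2 + (1 - x\<^sup>2) * (poly B x)\<^sup>2 =
         ((poly C x)\<^sup>2 + (1 - x\<^sup>2) * (poly D x)\<^sup>2) * ((poly E x)\<^sup>2 + (1 - x\<^sup>2) * (poly F x)\<^sup>2)"
proof -
  have g: "graded N C" "graded N (pCons 0 D)" "graded M E" "graded M (pCons 0 F)"
    using assms by (auto simp: sos_form_def)
  \<comment> \<open>\<open>x^2 D F\<close> has order \<open>N + M\<close>; dividing by
    \<open>x^2\<close> keeps the parity and lowers the degree, so \<open>D F\<close> is graded by
    \<open>N + M\<close> too.\<close>
  have xx: "graded (N + M) (pCons 0 (pCons 0 (D * F)))"
    using graded_mult[OF g(2,4)] by simp
  then have DF: "graded (N + M) (D * F)"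
    unfolding graded_def
  proof (intro allI impI)
    fix i assume *: "\<forall>i. coeff (pCons 0 (pCons 0 (D * F))) i \<noteq> 0 \<longrightarrow> i \<le> N + M \<and> even (N + M + i)"
      "coeff (D * F) i \<noteq> 0"
    then have "coeff (pCons 0 (pCons 0 (D * F))) (Suc (Suc i)) \<noteq> 0" by simp
    with *(1) have "Suc (Suc i) \<le> N + M \<and> even (N + M + Suc (Suc i))" by blast
    then show "i \<le> N + M \<and> even (N + M + i)" by simp
  qed
  have "A = C * E - D * F + pCons 0 (pCons 0 (D * F))"
    unfolding A_def by (simp add: algebra_simps)
  then have A: "graded (N + M) A"
    using graded_add[OF graded_diff[OF graded_mult[OF g(1,3)] DF] xx] by simp
  have "pCons 0 B = C * pCons 0 F + pCons 0 D * E"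
    unfolding B_def by (simp add: algebra_simps)
  then have "graded (N + M) (pCons 0 B)"
    using graded_add[OF graded_mult[OF g(1,4)] graded_mult[OF g(2,3)]] by simp
  with A show "sos_form (N + M) A B" by (simp add: sos_form_def)
  show "(poly A x)\<^sup>2 + (1 - x\<^sup>2) * (poly B x)\<^sup>2 =
         ((poly C x)\<^sup>2 + (1 - x\<^sup>2) * (poly D x)\<^sup>2) * ((poly E x)\<^sup>2 + (1 - x\<^sup>2) * (poly F x)\<^sup>2)"
    unfolding A_def B_def by (simp add: power2_eq_square algebra_simps)
qed

text \<open>Even polynomials in \<open>x\<close> are written as \<open>R\<close> at
  \<open>x^2\<close>. As \<open>R(x^2)\<close> has degree \<open>2 * degree R\<close>, the order
  \<open>degree R\<close> for \<open>C\<close> and \<open>D\<close> is half of that.\<close>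

definition sos_rep :: "real poly \<Rightarrow> bool" where
  "sos_rep R \<longleftrightarrow> (\<exists>C D. sos_form (degree R) C D \<and>
     (\<forall>x. poly R (x\<^sup>2) = (poly C x)\<^sup>2 + (1 - x\<^sup>2) * (poly D x)\<^sup>2))"

lemma sos_rep_mult:
  assumes "sos_rep R" "sos_rep S" "R \<noteq> 0" "S \<noteq> 0"
  shows "sos_rep (R * S)"
proof -
  obtain C D where 1: "sos_form (degree R) C D"
     "\<And>x. poly R (x\<^sup>2) = (poly C x)\<^sup>2 + (1 - x\<^sup>2) * (poly D x)\<^sup>2"
    using assms(1) unfolding sos_rep_def by blast
  obtain E F where 2: "sos_form (degree S) E F"
     "\<And>x. poly S (x\<^sup>2) = (poly E x)\<^sup>2 + (1 - x\<^sup>2) * (poly F x)\<^sup>2"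
    using assms(2) unfolding sos_rep_def by blast
  show ?thesis unfolding sos_rep_def
    using sos_form_mult[OF 1(1) 2(1)] assms(3,4) 1(2) 2(2) by (metis degree_mult_eq poly_mult)
qed

lemma sos_rep_const:
  assumes "c > 0" shows "sos_rep [:c:]"
  unfolding sos_rep_def
  by (rule exI[of _ "[:sqrt c:]"], rule exI[of _ 0])
     (use assms in \<open>auto simp: sos_form_def graded_def coeff_pCons split: nat.splits\<close>)

text \<open>Interpolation between the end points: \<open>b + a y = (a + b) y + b (1 - y)\<close>
  with \<open>y = x^2\<close>, and both weights are positive.\<close>

lemma sos_rep_linear:
  assumes "a \<noteq> 0" "poly [:b, a:] 0 > 0" "poly [:b, a:] 1 > 0"
  shows "sos_rep [:b, a:]"
  unfolding sos_rep_def
proof (rule exI[of _ "[:0, sqrt (a + b):]"], rule exI[of _ "[:sqrt b:]"], intro conjI allI)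
  show "sos_form (degree [:b, a:]) [:0, sqrt (a + b):] [:sqrt b:]"
    using assms by (auto simp: sos_form_def graded_def coeff_pCons split: nat.splits)
  fix x
  show "poly [:b, a:] (x\<^sup>2) = (poly [:0, sqrt (a + b):] x)\<^sup>2 + (1 - x\<^sup>2) * (poly [:sqrt b:] x)\<^sup>2"
    using assms by (simp add: power_mult_distrib algebra_simps)
qed

text \<open>The square of \<open>|z| - (|z| + |1 - z|) y\<close> agrees with \<open>|y - z|\<^sup>2\<close> at \<open>y = 0, 1\<close>;
  the triangle inequality makes the remaining multiple of \<open>y (1 - y)\<close> nonnegative.\<close>

lemma sos_rep_quadratic:
  fixes z :: complex
  shows "sos_rep [:(cmod z)\<^sup>2, - 2 * Re z, 1:]"
  unfolding sos_rep_def
proof -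
  define s where "s = cmod z + cmod (1 - z)"
  have "s \<ge> 1" unfolding s_def using norm_triangle_ineq[of z "1 - z"] by simp
  then have s: "s\<^sup>2 - 1 \<ge> 0" by (simp add: power2_eq_square mult_mono[of 1 s 1 s, simplified])
  have "cmod (1 - z)^2 = 1 - 2 * Re z + cmod z ^ 2"
    unfolding cmod_power2 by (simp add: power2_eq_square algebra_simps)
  then have e: "s\<^sup>2 - 2 * s * cmod z = 1 - 2 * Re z"
    unfolding s_def by (simp add: power2_eq_square algebra_simps)
  show "\<exists>C D. sos_form (degree [:(cmod z)\<^sup>2, - 2 * Re z, 1:]) C D \<and>
     (\<forall>x. poly [:(cmod z)\<^sup>2, - 2 * Re z, 1:] (x\<^sup>2) = (poly C x)\<^sup>2 + (1 - x\<^sup>2) * (poly D x)\<^sup>2)"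
  proof (rule exI[of _ "[:cmod z, 0, -s:]"], rule exI[of _ "[:0, sqrt (s\<^sup>2 - 1):]"], intro conjI allI)
    show "sos_form (degree [:(cmod z)\<^sup>2, - 2 * Re z, 1:]) [:cmod z, 0, -s:] [:0, sqrt (s\<^sup>2 - 1):]"
      by (auto simp: sos_form_def graded_def coeff_pCons split: nat.splits)
    fix x :: real
    have "(poly [:cmod z, 0, -s:] x)\<^sup>2 + (1 - x\<^sup>2) * (poly [:0, sqrt (s\<^sup>2 - 1):] x)\<^sup>2
      = (cmod z - s * x\<^sup>2)\<^sup>2 + (1 - x\<^sup>2) * x\<^sup>2 * (s\<^sup>2 - 1)"
      using s by (simp add: power_mult_distrib algebra_simps power2_eq_square)
    also have "\<dots> = (cmod z)\<^sup>2 + (s\<^sup>2 - 2 * s * cmod z - 1) * x\<^sup>2 + x^4"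
      by (simp add: algebra_simps power2_eq_square power4_eq_xxxx)
    also have "\<dots> = poly [:(cmod z)\<^sup>2, - 2 * Re z, 1:] (x\<^sup>2)"
      unfolding e by (simp add: algebra_simps power2_eq_square power4_eq_xxxx)
    finally show "poly [:(cmod z)\<^sup>2, - 2 * Re z, 1:] (x\<^sup>2) =
      (poly [:cmod z, 0, -s:] x)\<^sup>2 + (1 - x\<^sup>2) * (poly [:0, sqrt (s\<^sup>2 - 1):] x)\<^sup>2" ..
  qed
qed

text \<open>The quadratic is the minimal polynomial of \<open>z\<close> over the reals. The linear
  remainder of \<open>R\<close> vanishes at \<open>z\<close> as well, and a real linear polynomial
  with a nonreal root is zero.\<close>

lemma real_quadratic_dvd:
  fixes R :: "real poly"
  assumes root: "poly (map_poly complex_of_real R) z = 0" and im: "Im z \<noteq> 0"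
  shows "[:(cmod z)\<^sup>2, - 2 * Re z, 1:] dvd R"
proof -
  define q where "q = [:(cmod z)\<^sup>2, - 2 * Re z, 1:]"
  interpret of_real_poly_hom: map_poly_idom_hom complex_of_real ..
  have "(of_real ((cmod z)\<^sup>2) :: complex) - 2 * Re z * z + z * z = 0"
    unfolding cmod_power2 by (simp add: complex_eq_iff power2_eq_square algebra_simps)
  then have qz: "poly (map_poly complex_of_real q) z = 0"
    by (simp add: q_def algebra_simps)
  have deg: "degree (R mod q) \<le> 1"
    using degree_mod_less'[of q R] by (cases "R mod q = 0") (auto simp: q_def)
  then obtain a b where ab: "R mod q = [:b, a:]"
    by (metis One_nat_def degree_0 degree_eq_zeroE degree_pCons_eq_if le_Suc_eq le_zero_eq pCons_cases Suc_inject pCons_0_0)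
  have "poly (map_poly complex_of_real (R div q * q + R mod q)) z = 0"
    using root by simp
  then have "poly (map_poly complex_of_real (R mod q)) z = 0"
    using qz by (simp only: of_real_poly_hom.hom_add of_real_poly_hom.hom_mult poly_add poly_mult) simp
  then have "of_real b + of_real a * z = 0" by (simp add: ab of_real_hom.map_poly_pCons_hom algebra_simps)
  then have "a = 0" "b = 0" using im by (auto simp: complex_eq_iff)
  then show ?thesis using ab by (simp add: q_def mod_eq_0_iff_dvd)
qed

text \<open>Induction on the degree splits off one factor that is positive on the interval, so that
  the quotient is positive there too. A nonreal root gives a quadratic factor; a real root lies
  outside \<open>[0, 1]\<close> and gives a linear one.\<close>

theorem markov_lukacs:
  fixes R :: "real poly"
  assumes "\<And>y. 0 \<le> y \<Longrightarrow> y \<le> 1 \<Longrightarrow> poly R y > 0"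
  shows "sos_rep R"
  using assms
proof (induction "degree R" arbitrary: R rule: less_induct)
  case less
  have R0: "R \<noteq> 0" using less.prems[of 0] by auto
  have step: "sos_rep R" if F: "F dvd R" "degree F > 0" "sos_rep F"
      "\<And>y. 0 \<le> y \<Longrightarrow> y \<le> 1 \<Longrightarrow> poly F y > 0" for F
  proof -
    obtain S where S: "R = F * S" using F(1) by (elim dvdE)
    have nz: "F \<noteq> 0" "S \<noteq> 0" using R0 S by auto
    have "poly S y > 0" if "0 \<le> y" "y \<le> 1" for y
      using less.prems[OF that] F(4)[OF that] by (simp add: S zero_less_mult_iff)
    moreover have "degree S < degree R" using F(2) nz by (simp add: S degree_mult_eq)
    ultimately have "sos_rep S" using less.hyps by blast
    then show ?thesis using sos_rep_mult[OF F(3)] nz S by simp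
  qed
  show ?case
  proof (cases "degree R = 0")
    case True
    then obtain c where "R = [:c:]" using degree_eq_zeroE by blast
    then show ?thesis using sos_rep_const less.prems[of 0] by simp
  next
    case False
    then have "\<not> constant (poly (map_poly complex_of_real R))"
      by (simp add: constant_degree degree_map_poly)
    then obtain z where z: "poly (map_poly complex_of_real R) z = 0"
      using fundamental_theorem_of_algebra by blast
    show ?thesis
    proof (cases "Im z = 0")
      case False
      have pos: "poly [:(cmod z)\<^sup>2, - 2 * Re z, 1:] y > 0" for y
      proof -
        have "poly [:(cmod z)\<^sup>2, - 2 * Re z, 1:] y = (y - Re z)\<^sup>2 + (Im z)\<^sup>2"
          unfolding cmod_power2 by (simp add: power2_eq_square algebra_simps)
        then show ?thesis using False by (simp add: add_nonneg_pos)
      qed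
      show ?thesis
        by (rule step[OF real_quadratic_dvd[OF z False] _ sos_rep_quadratic pos]) simp
    next
      case True
      then have "z = of_real (Re z)" by (simp add: complex_eq_iff)
      then have r: "poly R (Re z) = 0" using z
        by (metis of_real_eq_0_iff of_real_hom.poly_map_poly)
      then have d: "[:- Re z, 1:] dvd R" by (simp add: poly_eq_0_iff_dvd)
      have out: "Re z < 0 \<or> Re z > 1" using r less.prems[of "Re z"] by force
      then show ?thesis
      proof
        assume "Re z < 0"
        then show ?thesis by (intro step[OF d] sos_rep_linear) auto
      next
        assume z1: "Re z > 1"
        \<comment> \<open>For a root above 1 the sign is flipped, so that the factor is positive on
          \<open>[0, 1]\<close>.\<close>
        have "[:Re z, -1:] = - [:- Re z, 1:]" by simp
        then have "[:Re z, -1:] dvd R" using d by (simp only: minus_dvd_iff)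
        then show ?thesis using z1 by (intro step[of "[:Re z, -1:]"] sos_rep_linear) auto
      qed
    qed
  qed
qed


section \<open>Complementary polynomials of an odd polynomial\<close>

text \<open>Two coefficients are stripped per induction step. The exact degree is recorded because
  \<open>sos_rep\<close> ties its order to the degree.\<close>

lemma odd_poly_decomp:
  fixes p :: "real poly"
  assumes "\<And>i. even i \<Longrightarrow> coeff p i = 0" "p \<noteq> 0"
  shows "\<exists>q. q \<noteq> 0 \<and> degree p = Suc (2 * degree q) \<and> (\<forall>x. poly p x = x * poly q (x\<^sup>2))"
  using assms
proof (induction "degree p" arbitrary: p rule: less_induct)
  case less
  obtain a b r where p: "p = pCons a (pCons b r)" by (metis pCons_cases)
  have a: "a = 0" using less.prems(1)[of 0] by (simp add: p)
  have r: "coeff r i = 0" if "even i" for i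
    using less.prems(1)[of "Suc (Suc i)"] that by (simp add: p)
  show ?case
  proof (cases "r = 0")
    case True
    then show ?thesis using less.prems(2) by (intro exI[of _ "[:b:]"]) (auto simp: p a)
  next
    case False
    then have "degree r < degree p" by (simp add: p)
    then obtain q where q: "q \<noteq> 0" "degree r = Suc (2 * degree q)" "\<And>x. poly r x = x * poly q (x\<^sup>2)"
      using less.hyps[of r] r False by blast
    show ?thesis
      by (rule exI[of _ "pCons b q"])
         (use q False in \<open>auto simp: p a power2_eq_square algebra_simps\<close>)
  qed
qed

text \<open>Writing \<open>p = x q(x^2)\<close> gives \<open>1 - p^2 = R(x^2)\<close> with
  \<open>R = 1 - y q^2\<close>, which is positive on \<open>[0, 1]\<close> by the strict bound, so
  that \<open>markov_lukacs\<close> applies. The order it yields, \<open>degree p\<close>, is odd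
  and can be raised to \<open>m\<close>.\<close>

lemma complementary_polys:
  fixes p :: "real poly"
  assumes m: "odd m" and p: "graded m p" "p \<noteq> 0"
    and bound: "\<And>x. \<bar>x\<bar> \<le> 1 \<Longrightarrow> \<bar>poly p x\<bar> < 1"
  shows "\<exists>C D. sos_form m C D \<and>
    (\<forall>x. (poly p x)\<^sup>2 + (poly C x)\<^sup>2 + (1 - x\<^sup>2) * (poly D x)\<^sup>2 = 1)"
proof -
  have "coeff p i = 0" if "even i" for i using gradedD[OF p(1)] m that by simp
  then obtain q where q: "q \<noteq> 0" "degree p = Suc (2 * degree q)" "\<And>x. poly p x = x * poly q (x\<^sup>2)"
    using odd_poly_decomp p(2) by blast
  define R where "R = 1 - pCons 0 (q * q)"
  \<comment> \<open>The degree of \<open>y q^2\<close> is odd, hence positive, so subtracting it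
    from 1 leaves the degree unchanged.\<close>
  have deg': "degree (pCons 0 (q * q)) = degree p" using q by (simp add: degree_mult_eq)
  then have deg: "degree R = degree p"
    unfolding R_def diff_conv_add_uminus
    by (subst degree_add_eq_right) (simp_all only: degree_minus degree_1 q(2))
  have "poly R y > 0" if y: "0 \<le> y" "y \<le> 1" for y
  proof -
    have "(poly p (sqrt y))\<^sup>2 < 1" using bound[of "sqrt y"] y by (simp add: abs_square_less_1)
    then have "y * (poly q y)\<^sup>2 < 1" using y by (simp add: q(3) power_mult_distrib)
    then show ?thesis by (simp add: R_def power2_eq_square)
  qed
  then obtain C D where CD: "sos_form (degree p) C D"
    "\<And>x. poly R (x\<^sup>2) = (poly C x)\<^sup>2 + (1 - x\<^sup>2) * (poly D x)\<^sup>2"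
    using markov_lukacs[of R] unfolding sos_rep_def deg by blast
  have "even (degree p + m)" "degree p \<le> m" using q(2) m graded_degree[OF p(1)] by auto
  then have "sos_form m C D" using CD(1) graded_mono unfolding sos_form_def by blast
  moreover have "(poly p x)\<^sup>2 + (poly C x)\<^sup>2 + (1 - x\<^sup>2) * (poly D x)\<^sup>2 = 1" for x
    using CD(2)[of x] by (simp add: R_def q(3) power_mult_distrib power2_eq_square algebra_simps)
  ultimately show ?thesis by blast
qed

section \<open>Quantum signal processing\<close>

text \<open>The first column of the product of the factors
  \<open>diag(e^(i phi), e^(-i phi)) R(x)\<close>, one for each phase; the empty product gives
  \<open>(1, 0)\<close>.\<close>

fun qsp :: "real list \<Rightarrow> real \<Rightarrow> complex \<times> complex" where
  "qsp [] x = (1, 0)"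
| "qsp (\<phi> # \<Phi>) x =
    (cis \<phi> * (of_real x * fst (qsp \<Phi> x) + of_real (sqrt (1 - x\<^sup>2)) * snd (qsp \<Phi> x)),
     cis (- \<phi>) * (of_real (sqrt (1 - x\<^sup>2)) * fst (qsp \<Phi> x) - of_real x * snd (qsp \<Phi> x)))"

text \<open>The reflections are real, so negating all phases conjugates the whole product.\<close>

lemma qsp_uminus: "qsp (map uminus \<Phi>) x = (cnj (fst (qsp \<Phi> x)), cnj (snd (qsp \<Phi> x)))"
  by (induction \<Phi>) (auto simp: cis_cnj)

text \<open>Parity already kills the coefficient of order \<open>k + 1\<close>, so one vanishing top
  coefficient lowers the order by two.\<close>

lemma graded_drop:
  assumes "graded (Suc (Suc k)) p" "coeff p (Suc (Suc k)) = 0"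
  shows "graded k p"
  unfolding graded_def
proof (intro allI impI)
  fix i assume i: "coeff p i \<noteq> 0"
  then have "i \<le> Suc (Suc k)" "even (Suc (Suc k) + i)" using assms(1) unfolding graded_def by blast+
  moreover have "i \<noteq> Suc (Suc k)" using i assms(2) by auto
  moreover from calculation have "i \<noteq> Suc k" by auto
  ultimately show "i \<le> k \<and> even (k + i)" by auto
qed

text \<open>The norm identity holds at infinitely many points, hence as an identity of polynomials.
  Its coefficient at \<open>x^(2k+2)\<close> is the difference of the squared moduli of the two top
  coefficients.\<close>

lemma unitary_pair_top_coeffs:
  fixes P Q :: "complex poly"
  assumes g: "degree P \<le> Suc k" "degree Q \<le> k"
    and norm: "\<And>x::real. (cmod (poly P (of_real x)))\<^sup>2 + (1 - x\<^sup>2) * (cmod (poly Q (of_real x)))\<^sup>2 = 1"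
  shows "cmod (coeff P (Suc k)) = cmod (coeff Q k)"
proof -
  \<comment> \<open>Conjugating the coefficients conjugates the values at real points, so
    \<open>H\<close> is the norm identity as a polynomial.\<close>
  define H where "H = P * map_poly cnj P + [:1, 0, -1:] * (Q * map_poly cnj Q) - 1"
  have cnj: "poly (map_poly cnj p) (of_real x) = cnj (poly p (of_real x))" for p and x :: real
    by (metis complex_cnj_complex_of_real poly_cnj)
  have "poly H (of_real x) = 0" for x :: real
  proof -
    have "poly H (of_real x) = of_real ((cmod (poly P (of_real x)))\<^sup>2 + (1 - x\<^sup>2) * (cmod (poly Q (of_real x)))\<^sup>2 - 1)"
      by (simp add: H_def cnj power2_eq_square algebra_simps flip: complex_norm_square)
    then show ?thesis using norm[of x] by simp
  qed
  then have "range complex_of_real \<subseteq> {z. poly H z = 0}" by auto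
  moreover have "infinite (range complex_of_real)"
    using infinite_UNIV_char_0 by (metis finite_imageD inj_of_real)
  ultimately have H0: "H = 0" using poly_roots_finite finite_subset by blast
  have dc: "degree (map_poly cnj p) = degree p" for p by (simp add: degree_map_poly)
  have "coeff H (Suc k + Suc k) = coeff P (Suc k) * cnj (coeff P (Suc k))
      + coeff ([:1, 0, -1:] * (Q * map_poly cnj Q)) (2 + (k + k))"
    unfolding H_def using g dc coeff_mult_top[of P "Suc k" "map_poly cnj P" "Suc k"]
    by (simp add: coeff_map_poly numeral_2_eq_2)
  also have "coeff ([:1, 0, -1:] * (Q * map_poly cnj Q)) (2 + (k + k)) = - (coeff Q k * cnj (coeff Q k))"
    using coeff_mult_top[of "[:1, 0, -1:]" 2 "Q * map_poly cnj Q" "k + k"]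
      coeff_mult_top[of Q k "map_poly cnj Q" k] g dc degree_mult_le[of Q "map_poly cnj Q"]
    by (simp add: coeff_map_poly numeral_2_eq_2)
  finally have "coeff P (Suc k) * cnj (coeff P (Suc k)) = coeff Q k * cnj (coeff Q k)"
    using H0 by simp
  then show ?thesis
    by (metis complex_mod_mult_cnj norm_ge_zero power2_eq_iff_nonneg)
qed

text \<open>Half the argument of \<open>p / q\<close> does it. In \<open>qsp_exists\<close> this is
  the phase to be peeled off, which makes the top coefficients agree.\<close>

lemma cmod_eq_imp_double_phase:
  assumes "cmod p = cmod q"
  obtains \<phi> where "cis (- \<phi>) * p = cis \<phi> * q"
proof (cases "q = 0")
  case True
  then show ?thesis using that[of 0] assms by simp
next
  case False
  then have "cmod (p / q) = 1" using assms by (simp add: norm_divide)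
  then have "p / q = cis (Arg (p / q))"
    by (metis False assms cis_Arg div_0 norm_zero sgn_div_norm scaleR_one inverse_1 zero_neq_one)
  then have "p = cis (Arg (p / q)) * q" using False by (simp add: field_simps)
  then have "cis (- Arg (p / q) / 2) * p = cis (Arg (p / q) / 2) * q"
    by (metis (no_types, lifting) cis_mult mult.assoc add_divide_distrib field_sum_of_halves minus_add_cancel minus_divide_left)
  then show ?thesis using that[of "Arg (p / q) / 2"] by simp
qed

text \<open>Induction on \<open>m\<close> peels off the leftmost phase and reflection. The remaining
  column is again of the form \<open>(P', s Q')\<close> with \<open>s = sqrt (1 - x^2)\<close>, and
  its order drops to \<open>k\<close> because the phase makes the top coefficients cancel. At order
  0 only a constant \<open>c\<close> of modulus 1 is left.\<close>

lemma qsp_exists: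
  fixes P Q :: "complex poly"
  assumes "graded m P" "graded m (pCons 0 Q)"
    and "\<And>x::real. (cmod (poly P (of_real x)))\<^sup>2 + (1 - x\<^sup>2) * (cmod (poly Q (of_real x)))\<^sup>2 = 1"
  shows "\<exists>\<Phi> c. length \<Phi> = m \<and> cmod c = 1 \<and> (\<forall>x. \<bar>x\<bar> \<le> 1 \<longrightarrow>
     poly P (of_real x) = c * fst (qsp \<Phi> x) \<and>
     of_real (sqrt (1 - x\<^sup>2)) * poly Q (of_real x) = c * snd (qsp \<Phi> x))"
  using assms
proof (induction m arbitrary: P Q)
  case 0
  obtain c where c: "P = [:c:]" using graded_degree[OF 0(1)] degree_eq_zeroE by blast
  have "Q = 0" using graded_degree[OF 0(2)] by (metis degree_pCons_eq le_zero_eq nat.distinct(1))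
  then show ?case using 0(3)[of 0] c
    by (intro exI[of _ "[]"] exI[of _ c]) (auto simp: abs_square_eq_1)
next
  case (Suc k)
  have Q: "graded k Q" using Suc.prems(2) by (simp add: graded_pCons_0)
  obtain \<phi> where \<phi>: "cis (- \<phi>) * coeff P (Suc k) = cis \<phi> * coeff Q k"
    by (rule cmod_eq_imp_double_phase[OF unitary_pair_top_coeffs[OF
          graded_degree[OF Suc.prems(1)] graded_degree[OF Q] Suc.prems(3)]])
  define A where "A = smult (cis (- \<phi>)) P"
  define B where "B = smult (cis \<phi>) Q"
  \<comment> \<open>\<open>R(x)\<close> is its own inverse: applied to \<open>(A, s B)\<close> it
    gives \<open>x A + s^2 B\<close> and \<open>s (A - x B)\<close>, where
    \<open>s^2 = 1 - x^2\<close> is a polynomial.\<close>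
  define P' where "P' = pCons 0 A + (B - pCons 0 (pCons 0 B))"
  define Q' where "Q' = A - pCons 0 B"
  have A: "graded (Suc k) A" unfolding A_def using Suc.prems(1) by (rule graded_smult)
  have B: "graded k B" unfolding B_def using Q by (rule graded_smult)
  have top: "coeff A (Suc k) = coeff B k" using \<phi> by (simp add: A_def B_def)
  \<comment> \<open>The order is \<open>k + 2\<close> at first; the coefficient of
    \<open>x^(k+2)\<close> is the difference of the top coefficients of \<open>A\<close> and
    \<open>B\<close>, which is 0.\<close>
  have P': "graded k P'"
  proof (rule graded_drop)
    show "graded (Suc (Suc k)) P'" unfolding P'_def
      by (intro graded_add graded_diff) (auto simp: graded_pCons_0 A B intro: graded_mono[OF B])
    show "coeff P' (Suc (Suc k)) = 0"
      using top gradedD[OF B, of "Suc (Suc k)"] by (simp add: P'_def)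
  qed
  have Q': "graded k (pCons 0 Q')"
  proof (rule graded_drop)
    show "graded (Suc (Suc k)) (pCons 0 Q')" unfolding Q'_def graded_pCons_0
      by (intro graded_diff) (auto simp: graded_pCons_0 A B)
    show "coeff (pCons 0 Q') (Suc (Suc k)) = 0" using top by (simp add: Q'_def)
  qed
  have evP: "poly P' z = z * poly A z + (1 - z\<^sup>2) * poly B z" for z
    by (simp add: P'_def power2_eq_square algebra_simps)
  have evQ: "poly Q' z = poly A z - z * poly B z" for z by (simp add: Q'_def)
  have nA: "cmod (poly A z) = cmod (poly P z)" and nB: "cmod (poly B z) = cmod (poly Q z)" for z
    by (simp_all add: A_def B_def norm_mult)
  have "(cmod (poly P' (of_real x)))\<^sup>2 + (1 - x\<^sup>2) * (cmod (poly Q' (of_real x)))\<^sup>2 = 1" for x :: real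
  proof -
    \<comment> \<open>An identity valid for every real \<open>x\<close>, so no square root of
      \<open>1 - x^2\<close> enters.\<close>
    have "(cmod (of_real x * a + (1 - (of_real x)\<^sup>2) * b))\<^sup>2 + (1 - x\<^sup>2) * (cmod (a - of_real x * b))\<^sup>2
      = (cmod a)\<^sup>2 + (1 - x\<^sup>2) * (cmod b)\<^sup>2" for a b :: complex
      unfolding cmod_power2 by (simp add: power2_eq_square algebra_simps)
    then show ?thesis using Suc.prems(3)[of x] by (simp add: evP evQ nA nB)
  qed
  from Suc.IH[OF P' Q' this] obtain \<Phi> c where \<Phi>: "length \<Phi> = k" "cmod c = 1" and
    ev: "\<And>x. \<bar>x\<bar> \<le> 1 \<Longrightarrow> poly P' (of_real x) = c * fst (qsp \<Phi> x) \<and>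
     of_real (sqrt (1 - x\<^sup>2)) * poly Q' (of_real x) = c * snd (qsp \<Phi> x)"
    by blast
  show ?case
  proof (intro exI[of _ "\<phi> # \<Phi>"] exI[of _ c] conjI allI impI)
    fix x :: real assume x: "\<bar>x\<bar> \<le> 1"
    define s where "s = complex_of_real (sqrt (1 - x\<^sup>2))"
    define X where "X = complex_of_real x"
    have "1 - x\<^sup>2 \<ge> 0" using x by (simp add: abs_square_le_1)
    then have "complex_of_real (sqrt (1 - x\<^sup>2) * sqrt (1 - x\<^sup>2)) = of_real (1 - x\<^sup>2)" by simp
    then have ss: "s * s = 1 - X * X"
      unfolding s_def X_def of_real_mult by (simp add: power2_eq_square)
    have f: "c * fst (qsp \<Phi> x) = X * poly A X + s * s * poly B X"
      using ev[OF x] by (simp add: evP ss X_def power2_eq_square)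
    have g: "c * snd (qsp \<Phi> x) = s * (poly A X - X * poly B X)"
      using ev[OF x] by (simp add: evQ s_def X_def)
    have "c * fst (qsp (\<phi> # \<Phi>) x) = cis \<phi> * (X * (c * fst (qsp \<Phi> x)) + s * (c * snd (qsp \<Phi> x)))"
      by (simp add: X_def s_def algebra_simps)
    also have "\<dots> = cis \<phi> * ((X * X + s * s) * poly A X)" unfolding f g by (simp add: algebra_simps)
    also have "\<dots> = (cis \<phi> * cis (- \<phi>)) * poly P X" by (simp add: ss A_def)
    also have "\<dots> = poly P X" by (simp add: cis_mult)
    finally show "poly P (of_real x) = c * fst (qsp (\<phi> # \<Phi>) x)" by (simp add: X_def)
    have "c * snd (qsp (\<phi> # \<Phi>) x) = cis (- \<phi>) * (s * (c * fst (qsp \<Phi> x)) - X * (c * snd (qsp \<Phi> x)))"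
      by (simp add: X_def s_def algebra_simps)
    also have "\<dots> = cis (- \<phi>) * (s * ((X * X + s * s) * poly B X))" unfolding f g by (simp add: algebra_simps)
    also have "\<dots> = (cis (- \<phi>) * cis \<phi>) * (s * poly Q X)" by (simp add: ss B_def)
    also have "\<dots> = s * poly Q X" by (simp add: cis_mult)
    finally show "of_real (sqrt (1 - x\<^sup>2)) * poly Q (of_real x) = c * snd (qsp (\<phi> # \<Phi>) x)"
      by (simp add: X_def s_def)
  qed (use \<Phi> in auto)
qed

text \<open>\<open>complementary_polys\<close> supplies a unitary column
  \<open>(p + i C, s D)\<close>, which \<open>qsp_exists\<close> realises up to a constant of
  modulus 1; taking the real part discards \<open>C\<close>.\<close>

theorem qsp_real_poly:
  fixes p :: "real poly"
  assumes m: "odd m" and p: "graded m p" "p \<noteq> 0"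
    and bound: "\<And>x. \<bar>x\<bar> \<le> 1 \<Longrightarrow> \<bar>poly p x\<bar> < 1"
  shows "\<exists>\<Phi>. length \<Phi> = m \<and> (\<forall>x. \<bar>x\<bar> \<le> 1 \<longrightarrow> Re (fst (qsp \<Phi> x)) = poly p x)"
proof -
  obtain C D where CD: "graded m C" "graded m (pCons 0 D)"
    "\<And>x. (poly p x)\<^sup>2 + (poly C x)\<^sup>2 + (1 - x\<^sup>2) * (poly D x)\<^sup>2 = 1"
    using complementary_polys[OF assms] unfolding sos_form_def by blast
  let ?h = "map_poly complex_of_real"
  define P where "P = ?h p + smult \<i> (?h C)"
  have evh: "poly (?h r) (of_real x) = of_real (poly r x)" for r x
    by (simp add: of_real_hom.poly_map_poly)
  have gh: "graded m (?h r)" if "graded m r" for r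
    using that unfolding graded_def by (simp add: coeff_map_poly)
  have gP: "graded m P" unfolding P_def by (intro graded_add graded_smult gh p CD)
  have "?h (pCons 0 D) = pCons 0 (?h D)" by (simp add: of_real_hom.map_poly_pCons_hom)
  then have gQ: "graded m (pCons 0 (?h D))" using gh[OF CD(2)] by simp
  have evP: "poly P (of_real x) = Complex (poly p x) (poly C x)" for x
    by (simp add: P_def evh complex_eq_iff)
  have "(cmod (poly P (of_real x)))\<^sup>2 + (1 - x\<^sup>2) * (cmod (poly (?h D) (of_real x)))\<^sup>2 = 1" for x
    unfolding evP evh using CD(3)[of x] by (simp add: cmod_power2)
  from qsp_exists[OF gP gQ this] obtain \<Psi> c where *: "length \<Psi> = m" "cmod c = 1"
      "\<And>x. \<bar>x\<bar> \<le> 1 \<Longrightarrow> poly P (of_real x) = c * fst (qsp \<Psi> x)"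
    by blast
  from * m obtain \<phi> \<Phi> where \<Psi>: "\<Psi> = \<phi> # \<Phi>" by (cases \<Psi>) auto
  have c: "c = cis (Arg c)" using *(2)
    by (metis cis_Arg norm_zero sgn_div_norm scaleR_one inverse_1 zero_neq_one)
  show ?thesis
  \<comment> \<open>The constant \<open>c\<close> is absorbed into the first phase, which exists as
    \<open>m\<close> is odd: adding \<open>Arg c\<close> multiplies the first component by
    \<open>c\<close>.\<close>
  proof (intro exI[of _ "(Arg c + \<phi>) # \<Phi>"] conjI allI impI)
    fix x :: real assume "\<bar>x\<bar> \<le> 1"
    then have "poly P (of_real x) = c * fst (qsp \<Psi> x)" using * by simp
    also have "\<dots> = cis (Arg c) * fst (qsp \<Psi> x)" using c by simp
    also have "\<dots> = fst (qsp ((Arg c + \<phi>) # \<Phi>) x)" by (simp add: \<Psi> mult.assoc flip: cis_mult)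
    finally have "fst (qsp ((Arg c + \<phi>) # \<Phi>) x) = Complex (poly p x) (poly C x)" by (simp add: evP)
    then show "Re (fst (qsp ((Arg c + \<phi>) # \<Phi>) x)) = poly p x" by (simp only: complex.sel)
  qed (use * \<Psi> in simp)
qed

section \<open>Polynomial approximation of a steep linear ramp\<close>

text \<open>\<open>sin_ratio_poly j\<close> is the polynomial \<open>\<plusminus> T\<^sub>2\<^sub>j\<^sub>+\<^sub>1(u) / u\<close>.\<close>

fun sin_ratio_poly :: "nat \<Rightarrow> real poly" where
  "sin_ratio_poly 0 = 1"
| "sin_ratio_poly (Suc 0) = [:3, 0, -4:]"
| "sin_ratio_poly (Suc (Suc j)) = [:2, 0, -4:] * sin_ratio_poly (Suc j) - sin_ratio_poly j"

text \<open>The recursion is \<open>sin (a + 2t) = 2 cos (2t) sin a - sin (a - 2t)\<close>, with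
  \<open>2 cos (2t) = 2 - 4 u^2\<close> for \<open>u = sin t\<close>.\<close>

lemma poly_sin_ratio_poly: "poly (sin_ratio_poly j) (sin t) * sin t = sin (real (2 * j + 1) * t)"
proof (induction j rule: sin_ratio_poly.induct)
  case 1
  then show ?case by simp
next
  case 2
  have "sin (real (2 * Suc 0 + 1) * t) = sin (2 * t + t)" by (simp add: algebra_simps)
  also have "\<dots> = (3 - 4 * (sin t)\<^sup>2) * sin t"
    using cos_squared_eq[of t] unfolding sin_add sin_double cos_double_sin
    by (simp add: mult.assoc power2_eq_square) (simp add: algebra_simps)
  finally show ?case by (simp add: power2_eq_square algebra_simps)
next
  case (3 j)
  define a where "a = real (2 * Suc j + 1) * t"
  have e: "real (2 * Suc (Suc j) + 1) * t = a + 2 * t" "real (2 * j + 1) * t = a - 2 * t"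
    by (simp_all add: a_def algebra_simps)
  have "poly (sin_ratio_poly (Suc (Suc j))) (sin t) * sin t =
      2 * (1 - 2 * (sin t)\<^sup>2) * (poly (sin_ratio_poly (Suc j)) (sin t) * sin t)
      - poly (sin_ratio_poly j) (sin t) * sin t"
    by (simp add: power2_eq_square algebra_simps)
  also have "\<dots> = 2 * cos (2 * t) * sin a - sin (a - 2 * t)"
    unfolding 3 cos_double_sin e a_def[symmetric] ..
  also have "\<dots> = sin (a + 2 * t)" by (simp add: sin_add sin_diff)
  finally show ?case unfolding e .
qed

lemma sin_ratio_poly_0: "poly (sin_ratio_poly j) 0 = real (2 * j + 1)"
  by (induction j rule: sin_ratio_poly.induct) auto

lemma degree_sin_ratio_poly: "degree (sin_ratio_poly j) \<le> 2 * j"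
proof (induction j rule: sin_ratio_poly.induct)
  case (3 j)
  have "degree ([:2, 0, -4:] * sin_ratio_poly (Suc j)) \<le> 2 + 2 * Suc j"
    using degree_mult_le[of "[:2, 0, -4:]" "sin_ratio_poly (Suc j)"] 3 by simp
  then show ?case using 3 by (auto intro!: degree_diff_le)
qed auto

text \<open>The derivative \<open>cos x - 1/2\<close> of the difference is nonnegative on
  \<open>[0, 1]\<close>, since \<open>cos x = 1 - 2 sin^2 (x/2)\<close> and
  \<open>sin (x/2) \<le> 1/2\<close>.\<close>

lemma sin_ge_half: "sin y \<ge> y / 2" if "0 \<le> y" "y \<le> 1" for y :: real
proof -
  have "sin 0 - 0 / 2 \<le> sin y - y / 2"
  proof (rule DERIV_nonneg_imp_nondecreasing[OF that(1)])
    fix x assume x: "0 \<le> x" "x \<le> y"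
    have "((\<lambda>y. sin y - y / 2) has_real_derivative cos x - 1 / 2) (at x)"
      by (auto intro!: derivative_eq_intros)
    moreover have "1 / 2 \<le> cos x"
    proof -
      have "(sin (x / 2))\<^sup>2 \<le> (1 / 2)\<^sup>2"
        using x that sin_x_le_x[of "x / 2"] sin_ge_zero[of "x / 2"] pi_ge_two
        by (intro power_mono) auto
      then show ?thesis using cos_double_sin[of "x / 2"] by (simp add: power2_eq_square)
    qed
    ultimately show "\<exists>z. ((\<lambda>y. sin y - y / 2) has_real_derivative z) (at x) \<and> 0 \<le> z"
      by (intro exI conjI) auto
  qed
  then show ?thesis by simp
qed

text \<open>With \<open>u = sin t\<close>, the value of the polynomial times \<open>u\<close> is a
  sine.\<close>

lemma sin_ratio_poly_upper:
  assumes "0 < \<bar>u\<bar>" "\<bar>u\<bar> \<le> 1"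
  shows "\<bar>poly (sin_ratio_poly j) u\<bar> \<le> 1 / \<bar>u\<bar>"
proof -
  have "poly (sin_ratio_poly j) u * u = sin (real (2 * j + 1) * arcsin u)"
    using poly_sin_ratio_poly[of j "arcsin u"] assms by simp
  then have "\<bar>poly (sin_ratio_poly j) u\<bar> * \<bar>u\<bar> \<le> 1"
    by (metis abs_mult abs_sin_le_one)
  then show ?thesis using assms by (simp add: field_simps)
qed

text \<open>With \<open>u = sin t\<close> and \<open>M = 2j + 1\<close>, the bound on
  \<open>u\<close> gives \<open>t \<le> 1/M\<close>. Hence
  \<open>sin (M t) \<ge> M t / 2 \<ge> M u / 2\<close>, and dividing by \<open>u\<close> gives the
  claim; \<open>u = 0\<close> is treated apart.\<close>

lemma sin_ratio_poly_lower:
  assumes "0 \<le> u" "u \<le> 1 / (2 * real (2 * j + 1))"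
  shows "real (2 * j + 1) / 2 \<le> poly (sin_ratio_poly j) u"
proof (cases "u = 0")
  case True
  then show ?thesis by (simp add: sin_ratio_poly_0)
next
  case False
  define M where "M = real (2 * j + 1)"
  define t where "t = arcsin u"
  have M: "M \<ge> 1" by (simp add: M_def)
  have u: "0 < u" "u \<le> 1 / M / 2" using False assms by (auto simp: M_def)
  have "1 / M \<le> 1" using M by simp
  moreover have "0 \<le> 1 / M" using M by simp
  ultimately have u1: "u \<le> sin (1 / M)" using u sin_ge_half[of "1 / M"] by linarith
  have "1 / M / 2 \<le> 1" using M by (simp add: field_simps)
  with u(2) have u2: "u \<le> 1" by (rule order.trans)
  have "1 / M \<le> pi / 2" using \<open>1 / M \<le> 1\<close> pi_ge_two by linarith
  moreover have "- (pi / 2) \<le> 1 / M" using \<open>0 \<le> 1 / M\<close> pi_ge_two by linarith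
  ultimately have "arcsin (sin (1 / M)) = 1 / M" by (simp add: arcsin_sin)
  moreover have "arcsin u \<le> arcsin (sin (1 / M))"
    using u u1 by (intro arcsin_le_arcsin) auto
  ultimately have t1: "t \<le> 1 / M" by (simp add: t_def)
  have st: "sin t = u" using u u1 u2 by (simp add: t_def)
  have t0: "0 \<le> t" using arcsin_le_arcsin[of 0 u] u u1 u2 by (simp add: t_def)
  have "u \<le> t" using sin_x_le_x[OF t0] st by simp
  then have "M * u / 2 \<le> M * t / 2" using M by simp
  also have "\<dots> \<le> sin (M * t)"
    using t0 t1 M by (intro sin_ge_half) (auto simp: field_simps)
  also have "\<dots> = poly (sin_ratio_poly j) u * u"
    using poly_sin_ratio_poly[of j t] st by (simp add: M_def)
  finally have "M / 2 * u \<le> poly (sin_ratio_poly j) u * u" by simp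
  then show ?thesis using u(1) unfolding M_def by (rule mult_right_le_imp_le)
qed

section \<open>Polynomial step functions\<close>

lemma poly_antiderivative:
  fixes p :: "real poly"
  obtains A where "pderiv A = p" "degree A \<le> Suc (degree p)"
proof
  define A where "A = (\<Sum>i\<le>degree p. monom (coeff p i / real (Suc i)) (Suc i))"
  have "coeff A (Suc n) = coeff p n / real (Suc n)" for n
    by (auto simp: A_def coeff_sum coeff_monom coeff_eq_0 simp del: of_nat_Suc)
  then show "pderiv A = p" by (intro poly_eqI) (simp add: coeff_pderiv)
  show "degree A \<le> Suc (degree p)"
    unfolding A_def by (intro degree_sum_le) (auto intro: order.trans[OF degree_monom_le])
qed

text \<open>\<open>F 1 - F \<Delta>\<close> stands for the integral of \<open>f\<close>. The
  function \<open>F u + B / u\<close> has derivative \<open>f u - B / u^2 \<le> 0\<close>, so it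
  does not increase on the interval.\<close>

lemma inverse_square_tail:
  fixes F f :: "real \<Rightarrow> real"
  assumes "0 < \<Delta>" "\<Delta> \<le> 1" "B \<ge> 0"
    and F: "\<And>u. (F has_real_derivative f u) (at u)"
    and f: "\<And>u. \<Delta> \<le> u \<Longrightarrow> u \<le> 1 \<Longrightarrow> f u \<le> B / u\<^sup>2"
  shows "F 1 - F \<Delta> \<le> B / \<Delta>"
proof -
  have "F 1 + B / 1 \<le> F \<Delta> + B / \<Delta>"
  proof (rule DERIV_nonpos_imp_nonincreasing[OF assms(2)])
    fix x assume x: "\<Delta> \<le> x" "x \<le> 1"
    then have "((\<lambda>u. F u + B / u) has_real_derivative f x - B / x\<^sup>2) (at x)"
      using assms(1) by (auto intro!: derivative_eq_intros F simp: power2_eq_square)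
    then show "\<exists>y. ((\<lambda>u. F u + B / u) has_real_derivative y) (at x) \<and> y \<le> 0"
      using f[OF x] by (intro exI conjI) auto
  qed
  then show ?thesis using assms(3) by simp
qed

text \<open>A smoothed step function: the integral of \<open>(T\<^sub>M(u) / u)\<^sup>2\<^sup>N\<close>, a kernel whose tails are
  below \<open>u\<^sup>-\<^sup>2\<^sup>N\<close> while it exceeds \<open>(M / 2)\<^sup>2\<^sup>N\<close> on an interval of length \<open>1 / (2 M)\<close>.\<close>

lemma step_poly:
  fixes \<Delta> :: real and j n :: nat
  assumes \<Delta>: "0 < \<Delta>" "\<Delta> \<le> 1" and big: "real (2 * j + 1) * \<Delta> \<ge> 4"
  defines "\<eta> \<equiv> 8 / 4 ^ Suc n"
  obtains S :: "real poly" where "degree S \<le> 4 * j * Suc n + 1"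
    "\<And>u. \<bar>u\<bar> \<le> 1 \<Longrightarrow> 0 \<le> poly S u \<and> poly S u \<le> 1"
    "\<And>u. \<Delta> \<le> u \<Longrightarrow> u \<le> 1 \<Longrightarrow> poly S u \<le> \<eta>"
    "\<And>u. -1 \<le> u \<Longrightarrow> u \<le> -\<Delta> \<Longrightarrow> 1 - \<eta> \<le> poly S u"
proof -
  define M where "M = real (2 * j + 1)"
  define K where "K = sin_ratio_poly j ^ (2 * Suc n)"
  obtain A where A: "pderiv A = K" "degree A \<le> Suc (degree K)"
    using poly_antiderivative by blast
  have M: "M \<ge> 1" "M * \<Delta> \<ge> 4" using big by (auto simp: M_def)
  have Kev: "poly K u = \<bar>poly (sin_ratio_poly j) u\<bar> ^ (2 * Suc n)" for u
    by (simp add: K_def power_mult del: power_Suc)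
  have K0: "poly K u \<ge> 0" for u by (simp add: Kev)
  have dA: "(poly A has_real_derivative poly K u) (at u)" for u
    using poly_DERIV[of A u] A(1) by simp
  have mono: "poly A u \<le> poly A v" if "u \<le> v" for u v
    using that by (rule DERIV_nonneg_imp_nondecreasing) (use dA K0 in blast)
  \<comment> \<open>Two of the \<open>2n + 2\<close> powers of \<open>1 / |u|\<close> are kept for
    integration; the other \<open>2n\<close> are largest at \<open>\<Delta>\<close>.\<close>
  define B where "B = (1 / \<Delta>) ^ (2 * n)"
  have Ktail: "poly K u \<le> B / u\<^sup>2" if "\<Delta> \<le> \<bar>u\<bar>" "\<bar>u\<bar> \<le> 1" for u
  proof -
    have "poly K u \<le> (1 / \<bar>u\<bar>) ^ (2 * Suc n)"
      unfolding Kev using that \<Delta> sin_ratio_poly_upper[of u j] by (intro power_mono) auto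
    also have "\<dots> = (1 / \<bar>u\<bar>) ^ (2 * n) * (1 / \<bar>u\<bar>)\<^sup>2"
      by (simp add: power_add[symmetric])
    also have "\<dots> \<le> B * (1 / \<bar>u\<bar>)\<^sup>2"
      unfolding B_def using that \<Delta> by (intro mult_right_mono power_mono) (auto simp: frac_le)
    finally show ?thesis by (simp add: power_divide)
  qed
  have B0: "B \<ge> 0" using \<Delta> by (simp add: B_def)
  have right: "poly A 1 - poly A \<Delta> \<le> B / \<Delta>"
    by (rule inverse_square_tail[OF \<Delta> B0 dA]) (use Ktail \<Delta> in auto)
  have left: "poly A (-\<Delta>) - poly A (-1) \<le> B / \<Delta>"
  proof -
    \<comment> \<open>The reflection of \<open>u\<close> to \<open>-u\<close> turns the left tail
      into a right tail.\<close>
    have d: "((\<lambda>u. - poly A (- u)) has_real_derivative poly K (- u)) (at u)" for u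
      by (auto intro!: derivative_eq_intros DERIV_chain2[OF dA] simp: A(1))
    have "- poly A (- 1) - - poly A (- \<Delta>) \<le> B / \<Delta>"
      by (rule inverse_square_tail[OF \<Delta> B0 d]) (use Ktail[of "- u" for u] \<Delta> in auto)
    then show ?thesis by simp
  qed
  \<comment> \<open>\<open>s\<close> is the end of the interval on which
    \<open>sin_ratio_poly_lower\<close> holds; \<open>L\<close> below bounds the kernel from below
    there.\<close>
  define s where "s = 1 / (2 * M)"
  have s: "0 \<le> s" "s \<le> 1" using M by (auto simp: s_def)
  define L where "L = (M / 2) ^ (2 * Suc n)"
  have "poly A 0 - L * 0 \<le> poly A s - L * s"
  proof (rule DERIV_nonneg_imp_nondecreasing[OF s(1)])
    fix x assume x: "0 \<le> x" "x \<le> s"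
    then have "M / 2 \<le> \<bar>poly (sin_ratio_poly j) x\<bar>"
      using sin_ratio_poly_lower[of x j] by (simp add: M_def s_def)
    then have "L \<le> poly K x" unfolding Kev L_def using M by (intro power_mono) auto
    moreover have "((\<lambda>u. poly A u - L * u) has_real_derivative poly K x - L) (at x)"
      by (auto intro!: derivative_eq_intros simp: A(1))
    ultimately show "\<exists>y. ((\<lambda>u. poly A u - L * u) has_real_derivative y) (at x) \<and> 0 \<le> y"
      by (intro exI conjI) auto
  qed
  define T where "T = poly A 1 - poly A (-1)"
  have "L * s \<le> T"
    using \<open>poly A 0 - L * 0 \<le> poly A s - L * s\<close> mono[of "-1" 0] mono[of s 1] s by (simp add: T_def)
  moreover have "L * s = (M / 2) ^ (2 * n + 1) / 4"
    using M by (simp add: L_def s_def field_simps power2_eq_square)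
  ultimately have T: "(M / 2) ^ (2 * n + 1) / 4 \<le> T" by simp
  have Tpos: "T > 0" using M by (intro less_le_trans[OF _ T]) auto
  \<comment> \<open>Since \<open>M \<Delta> \<ge> 4\<close>, each tail is at most
    \<open>(M/4)^(2n+1)\<close>, while \<open>T \<ge> (M/2)^(2n+1) / 4\<close>. The quotient of
    these bounds is \<open>4 / 2^(2n+1) = \<eta>\<close>.\<close>
  have "B / \<Delta> \<le> \<eta> * T"
  proof -
    have "\<eta> * (1 / 4) = (1 / 2) ^ (2 * n + 1)"
      by (simp add: \<eta>_def power_mult power_divide)
    then have "\<eta> * ((M / 2) ^ (2 * n + 1) / 4) = (1 / 2) ^ (2 * n + 1) * (M / 2) ^ (2 * n + 1)"
      by (simp add: mult.commute)
    also have "\<dots> = (M / 4) ^ (2 * n + 1)" by (simp only: power_mult_distrib[symmetric]) simp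
    finally have "\<eta> * ((M / 2) ^ (2 * n + 1) / 4) = (M / 4) ^ (2 * n + 1)" .
    moreover have "(1 / \<Delta>) ^ (2 * n + 1) \<le> (M / 4) ^ (2 * n + 1)"
      using M \<Delta> by (intro power_mono) (auto simp: field_simps)
    moreover have "B / \<Delta> = (1 / \<Delta>) ^ (2 * n + 1)" by (simp add: B_def power_divide)
    moreover have "\<eta> * ((M / 2) ^ (2 * n + 1) / 4) \<le> \<eta> * T"
      using T by (intro mult_left_mono) (auto simp: \<eta>_def)
    ultimately show ?thesis by (metis order.trans)
  qed
  note tail = this
  \<comment> \<open>\<open>S u\<close> is the normalised integral of the kernel from
    \<open>u\<close> to 1; it falls from 1 at -1 to 0 at 1.\<close>
  define S where "S = smult (1 / T) ([:poly A 1:] - A)"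
  have S: "poly S u = (poly A 1 - poly A u) / T" for u by (simp add: S_def)
  show ?thesis
  proof (rule that[of S])
    have "degree K \<le> 2 * j * (2 * Suc n)"
      unfolding K_def using degree_power_le[of "sin_ratio_poly j" "2 * Suc n"]
        mult_le_mono1[OF degree_sin_ratio_poly[of j], of "2 * Suc n"] by (rule order.trans)
    then have "degree A \<le> 4 * j * Suc n + 1" using A(2) by (simp add: algebra_simps)
    then show "degree S \<le> 4 * j * Suc n + 1"
      unfolding S_def by (intro order.trans[OF degree_smult_le] degree_diff_le) auto
    fix u :: real
    show "0 \<le> poly S u \<and> poly S u \<le> 1" if "\<bar>u\<bar> \<le> 1"
      using mono[of u 1] mono[of "-1" u] that Tpos by (auto simp: S T_def)
    show "poly S u \<le> \<eta>" if "\<Delta> \<le> u" "u \<le> 1"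
      using mono[of \<Delta> u] that Tpos right tail by (auto simp: S field_simps)
    show "1 - \<eta> \<le> poly S u" if "-1 \<le> u" "u \<le> -\<Delta>"
    proof -
      have "(1 - \<eta>) * T \<le> poly A 1 - poly A u"
        using mono[of u "-\<Delta>"] that left tail by (simp add: T_def algebra_simps)
      then show ?thesis using Tpos by (simp add: S field_simps)
    qed
  qed
qed

section \<open>The amplification polynomial\<close>

text \<open>Substituting \<open>-x\<close> multiplies the coefficient of order \<open>i\<close> by
  \<open>(-1)^i\<close>, so the odd coefficients vanish.\<close>

lemma graded_even_function:
  fixes p :: "real poly"
  assumes "degree p \<le> 2 * l" "\<And>x. poly p (- x) = poly p x"
  shows "graded (2 * l) p"
  unfolding graded_def
proof (intro allI impI)
  fix i assume i: "coeff p i \<noteq> 0"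
  have "pcompose p [:0, -1:] = p"
    by (rule poly_eq_poly_eq_iff[THEN iffD1]) (auto simp: poly_pcompose assms(2))
  then have "coeff p i = (-1) ^ i * coeff p i" by (metis coeff_pcompose_linear)
  then have "even i" using i by (cases "even i") auto
  then show "i \<le> 2 * l \<and> even (2 * l + i)" using i assms(1) le_degree[OF i] by auto
qed

text \<open>For \<open>|x|\<close> up to \<open>(1 - \<delta>) / \<gamma>\<close> both steps are
  close to 1. From \<open>1 / \<gamma>\<close> on, one of them is at most \<open>\<eta>\<close>,
  which outweighs the factor \<open>\<gamma>\<close>. In between
  \<open>\<gamma> |x| \<le> 1\<close>, and it suffices that the steps lie between 0 and 1.\<close>

lemma amplification_poly:
  fixes \<gamma> \<delta> \<epsilon> :: real
  assumes \<gamma>: "\<gamma> > 1" and \<delta>: "0 < \<delta>" "\<delta> < 1/2" and \<epsilon>: "0 < \<epsilon>" "\<epsilon> < 1/2"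
  obtains m p where "odd m" "real m \<le> 651 * (\<gamma> / \<delta>) * ln (\<gamma> / \<epsilon>)" "graded m p"
    "\<And>x. \<bar>x\<bar> \<le> 1 \<Longrightarrow> \<bar>poly p x\<bar> < 1"
    "\<And>x. 0 < x \<Longrightarrow> x \<le> (1 - \<delta>) / \<gamma> \<Longrightarrow> \<bar>poly p x / (\<gamma> * x) - 1\<bar> \<le> \<epsilon>"
proof -
  \<comment> \<open>The centre \<open>c\<close> lies midway between
    \<open>(1 - \<delta>) / \<gamma>\<close> and \<open>1 / \<gamma>\<close>, at distance
    \<open>\<delta> / (2 \<gamma>)\<close> from both. \<open>S\<close> is evaluated at
    \<open>(x - c) / 2\<close>, to stay within \<open>[-1, 1]\<close>, which halves this distance to
    \<open>\<Delta>\<close>.\<close>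
  define \<Delta> where "\<Delta> = \<delta> / (4 * \<gamma>)"
  define c where "c = (1 - \<delta> / 2) / \<gamma>"
  \<comment> \<open>Chosen for \<open>(2j + 1) \<Delta> \<ge> 16 (\<gamma> / \<delta>) \<Delta> =
    4\<close>.\<close>
  define j where "j = nat \<lceil>8 * \<gamma> / \<delta>\<rceil>"
  \<comment> \<open>Chosen for \<open>4^N \<ge> e^N \<ge> 64 \<gamma> / \<epsilon>\<close>, that is,
    \<open>8 / 4^N \<le> \<epsilon> / (8 \<gamma>)\<close>.\<close>
  define N where "N = nat \<lceil>ln (64 * \<gamma> / \<epsilon>)\<rceil>"
  define n where "n = N - 1"
  define \<eta> where "\<eta> = (8::real) / 4 ^ Suc n"
  have g1: "\<gamma> / \<delta> \<ge> 2" using \<gamma> \<delta> by (simp add: field_simps)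
  have g2: "\<gamma> / \<epsilon> \<ge> 2" using \<gamma> \<epsilon> by (simp add: field_simps)
  define L where "L = ln (\<gamma> / \<epsilon>)"
  have L: "L \<ge> ln 2" unfolding L_def using g2 by (subst ln_le_cancel_iff) auto
  have L2: "L \<ge> 1 / 2" using L ln_le_minus_one[of "1 / 2"] by (simp add: ln_div)
  have "ln (64 * (\<gamma> / \<epsilon>)) = ln 64 + L" unfolding L_def using g2 by (subst ln_mult) auto
  moreover have "ln (64::real) = 6 * ln 2" using ln_realpow[of 2 6] by simp
  ultimately have lnN: "ln (64 * \<gamma> / \<epsilon>) = 6 * ln 2 + L" by simp
  have "ln (64 * \<gamma> / \<epsilon>) > 0" unfolding lnN using L2 by (intro add_pos_pos) auto
  then have N: "N \<ge> 1" "ln (64 * \<gamma> / \<epsilon>) \<le> real N" "real N \<le> ln (64 * \<gamma> / \<epsilon>) + 1"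
    unfolding N_def by linarith+
  have Nn: "Suc n = N" using N(1) by (simp add: n_def)
  \<comment> \<open>\<open>6 ln 2 \<le> 6 L\<close> and \<open>1 \<le> 2 L\<close> bound
    \<open>N\<close> by \<open>6 L + L + 2 L\<close>.\<close>
  have NL: "real N \<le> 9 * L" using N(3) lnN L L2 by linarith
  have j: "8 * (\<gamma> / \<delta>) \<le> real j" "real j \<le> 8 * (\<gamma> / \<delta>) + 1"
    unfolding j_def using g1 by linarith+
  then have jL: "real j \<le> 9 * (\<gamma> / \<delta>)" using g1 by linarith
  have \<Delta>: "0 < \<Delta>" "\<Delta> \<le> 1" using \<gamma> \<delta> by (auto simp: \<Delta>_def field_simps)
  have big: "real (2 * j + 1) * \<Delta> \<ge> 4"
  proof -
    have "4 = 16 * (\<gamma> / \<delta>) * \<Delta>" using \<gamma> \<delta> by (simp add: \<Delta>_def)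
    also have "\<dots> \<le> real (2 * j + 1) * \<Delta>" using j \<Delta> by (intro mult_right_mono) auto
    finally show ?thesis .
  qed
  obtain S :: "real poly" where S: "degree S \<le> 4 * j * Suc n + 1"
    "\<And>u. \<bar>u\<bar> \<le> 1 \<Longrightarrow> 0 \<le> poly S u \<and> poly S u \<le> 1"
    "\<And>u. \<Delta> \<le> u \<Longrightarrow> u \<le> 1 \<Longrightarrow> poly S u \<le> \<eta>"
    "\<And>u. -1 \<le> u \<Longrightarrow> u \<le> -\<Delta> \<Longrightarrow> 1 - \<eta> \<le> poly S u"
    unfolding \<eta>_def using step_poly[OF \<Delta> big] by blast
  have \<eta>: "\<eta> \<ge> 0" "\<eta> \<le> \<epsilon> / (8 * \<gamma>)"
  proof -
    have "64 * \<gamma> / \<epsilon> = exp (ln (64 * \<gamma> / \<epsilon>))" using \<gamma> \<epsilon> by simp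
    also have "\<dots> \<le> exp (real N)" using N by simp
    also have "\<dots> = exp 1 ^ N" by (simp add: exp_of_nat_mult[symmetric])
    also have "\<dots> \<le> 4 ^ N" using exp_le by (intro power_mono) auto
    finally have "8 / 4 ^ N \<le> 8 / (64 * \<gamma> / \<epsilon>)" using \<gamma> \<epsilon> by (intro divide_left_mono) auto
    then show "\<eta> \<le> \<epsilon> / (8 * \<gamma>)" using \<gamma> \<epsilon> by (simp add: \<eta>_def Nn)
  qed (simp add: \<eta>_def)
  \<comment> \<open>The product of a step and its mirror image is even, which makes
    \<open>x E\<close> odd.\<close>
  define E where "E = pcompose S [:- c / 2, 1 / 2:] * pcompose S [:- c / 2, - 1 / 2:]"
  define \<Sigma> where "\<Sigma> x = poly S ((x - c) / 2)" for x
  have E: "poly E x = \<Sigma> x * \<Sigma> (- x)" for x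
  proof -
    have "- c / 2 + x * (1 / 2) = (x - c) / 2" "- c / 2 + x * (- 1 / 2) = (- x - c) / 2" by simp_all
    then show ?thesis by (simp only: E_def poly_mult poly_pcompose \<Sigma>_def poly_pCons poly_0 mult_zero_right add_0_right)
  qed
  have c: "0 < c" "c < 1" using \<gamma> \<delta> by (auto simp: c_def field_simps)
  have \<Sigma>: "0 \<le> \<Sigma> x" "\<Sigma> x \<le> 1" if "\<bar>x\<bar> \<le> 1" for x
    using S(2)[of "(x - c) / 2"] that c by (auto simp: \<Sigma>_def)
  have \<Sigma>_lo: "1 - \<eta> \<le> \<Sigma> x" if "-1 \<le> x" "x \<le> (1 - \<delta>) / \<gamma>" for x
  proof -
    have "(x - c) / 2 \<le> ((1 - \<delta>) / \<gamma> - c) / 2"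
      using that by (intro divide_right_mono diff_right_mono) auto
    also have "\<dots> = - \<Delta>" using \<gamma> by (simp add: c_def \<Delta>_def field_simps)
    finally show ?thesis unfolding \<Sigma>_def using that c by (intro S(4)) auto
  qed
  have \<Sigma>_hi: "\<Sigma> x \<le> \<eta>" if "1 / \<gamma> \<le> x" "x \<le> 1" for x
  proof -
    have "\<Delta> = (1 / \<gamma> - c) / 2" using \<gamma> by (simp add: c_def \<Delta>_def field_simps)
    also have "\<dots> \<le> (x - c) / 2"
      using that by (intro divide_right_mono diff_right_mono) auto
    finally show ?thesis unfolding \<Sigma>_def using that c by (intro S(3)) auto
  qed
  have E01: "0 \<le> poly E x" "poly E x \<le> 1" if "\<bar>x\<bar> \<le> 1" for x
    using \<Sigma>[of x] \<Sigma>[of "-x"] that by (auto simp: E mult_le_one)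
  have Ehi: "poly E x \<le> \<eta>" if "1 / \<gamma> \<le> \<bar>x\<bar>" "\<bar>x\<bar> \<le> 1" for x
  proof -
    have "poly E x = \<Sigma> \<bar>x\<bar> * \<Sigma> (- \<bar>x\<bar>)" by (simp add: E abs_if)
    also have "\<dots> \<le> \<eta> * 1" using that \<Sigma>[of "- \<bar>x\<bar>"] \<eta> by (intro mult_mono \<Sigma>_hi) auto
    finally show ?thesis by simp
  qed
  \<comment> \<open>The factor \<open>k\<close> makes the bound on \<open>|p|\<close> strict, at the
    cost of a relative error of \<open>\<epsilon> / 4\<close>.\<close>
  define k where "k = 1 - \<epsilon> / 4"
  have k: "0 < k" "k < 1" using \<epsilon> by (auto simp: k_def)
  define p where "p = smult (k * \<gamma>) (pCons 0 E)"
  have p: "poly p x = k * (\<gamma> * x * poly E x)" for x by (simp add: p_def)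
  show ?thesis
  \<comment> \<open>\<open>E\<close> has degree at most \<open>2 (4 j N + 1)\<close>, and the factor
    \<open>x\<close> adds one.\<close>
  proof (rule that[of "8 * j * Suc n + 3" p])
    show "odd (8 * j * Suc n + 3)" by simp
    \<comment> \<open>The constant is \<open>651 = 8 * 81 + 3\<close>; the summand 3 is absorbed
      because \<open>X \<ge> 1\<close>.\<close>
    define X where "X = (\<gamma> / \<delta>) * L"
    have "real j * real N \<le> 9 * (\<gamma> / \<delta>) * (9 * L)"
      using jL NL g1 by (intro mult_mono) auto
    also have "\<dots> = 81 * X" by (simp add: X_def)
    finally have "real j * real N \<le> 81 * X" .
    moreover have "2 * (1 / 2) \<le> X" unfolding X_def using g1 L2 by (intro mult_mono) auto
    ultimately have "8 * (real j * real N) + 3 \<le> 651 * X" by simp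
    then show "real (8 * j * Suc n + 3) \<le> 651 * (\<gamma> / \<delta>) * ln (\<gamma> / \<epsilon>)"
      unfolding Nn X_def L_def by simp
    have "degree (pcompose S [:- c / 2, 1 / 2:]) \<le> 4 * j * Suc n + 1"
      "degree (pcompose S [:- c / 2, - 1 / 2:]) \<le> 4 * j * Suc n + 1"
      using S(1) degree_pcompose_le[of S "[:- c / 2, 1 / 2:]"]
        degree_pcompose_le[of S "[:- c / 2, - 1 / 2:]"] by auto
    then have "degree E \<le> 2 * (4 * j * Suc n + 1)"
      unfolding E_def mult_2 by (intro order.trans[OF degree_mult_le] add_mono)
    then have "graded (2 * (4 * j * Suc n + 1)) E"
      by (rule graded_even_function) (simp add: E)
    then have "graded (Suc (2 * (4 * j * Suc n + 1))) (pCons 0 E)" by (simp only: graded_pCons_0)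
    moreover have "Suc (2 * (4 * j * Suc n + 1)) = 8 * j * Suc n + 3" by simp
    ultimately have "graded (8 * j * Suc n + 3) (pCons 0 E)" by (simp only:)
    then show "graded (8 * j * Suc n + 3) p" unfolding p_def by (rule graded_smult)
    show "\<bar>poly p x\<bar> < 1" if x: "\<bar>x\<bar> \<le> 1" for x
    proof -
      have "\<gamma> * \<bar>x\<bar> * poly E x \<le> 1"
      proof (cases "1 / \<gamma> \<le> \<bar>x\<bar>")
        case True
        have "\<gamma> * \<bar>x\<bar> * poly E x \<le> \<gamma> * 1 * (\<epsilon> / (8 * \<gamma>))"
          using x \<gamma> \<eta> Ehi[OF True x] E01[OF x] by (intro mult_mono) auto
        also have "\<dots> \<le> 1" using \<gamma> \<epsilon> by simp
        finally show ?thesis .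
      next
        case False
        then have "\<gamma> * \<bar>x\<bar> \<le> 1" using \<gamma> by (simp add: field_simps)
        then show ?thesis by (rule mult_le_one) (use E01[OF x] in auto)
      qed
      then have "k * (\<gamma> * \<bar>x\<bar> * poly E x) \<le> k * 1" using k by (intro mult_left_mono) auto
      moreover have "\<bar>poly p x\<bar> = k * (\<gamma> * \<bar>x\<bar> * poly E x)"
        using k \<gamma> E01[OF x] by (simp add: p abs_mult)
      ultimately show ?thesis using k by linarith
    qed
    show "\<bar>poly p x / (\<gamma> * x) - 1\<bar> \<le> \<epsilon>" if x: "0 < x" "x \<le> (1 - \<delta>) / \<gamma>" for x
    proof -
      have "(1 - \<delta>) / \<gamma> \<le> 1" using \<gamma> \<delta> by (simp add: field_simps)
      then have x1: "\<bar>x\<bar> \<le> 1" using x by simp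
      have eq: "poly p x / (\<gamma> * x) = k * poly E x" using x \<gamma> by (simp add: p)
      have "\<epsilon> / (8 * \<gamma>) \<le> \<epsilon> / 8" using \<gamma> \<epsilon> by (intro divide_left_mono) auto
      then have e8: "\<eta> \<le> \<epsilon> / 8" using \<eta> by linarith
      \<comment> \<open>Both \<open>x\<close> and \<open>-x\<close> are at most
        \<open>(1 - \<delta>) / \<gamma>\<close>, so each factor is at least
        \<open>1 - \<eta>\<close>. Together with \<open>k\<close> this leaves
        \<open>(1 - \<epsilon>/4)^2 \<ge> 1 - \<epsilon>\<close>.\<close>
      have "(1 - \<eta>) * (1 - \<eta>) \<le> \<Sigma> x * \<Sigma> (- x)"
        using x x1 e8 \<epsilon> \<Sigma>[of x] by (intro mult_mono \<Sigma>_lo) auto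
      moreover have "1 - 2 * \<eta> \<le> (1 - \<eta>) * (1 - \<eta>)" by (simp add: algebra_simps)
      ultimately have E1: "1 - \<epsilon> / 4 \<le> poly E x" using e8 by (simp add: E)
      have "k * (1 - \<epsilon> / 4) \<le> k * poly E x" using k E1 by (intro mult_left_mono) auto
      moreover have "1 - \<epsilon> \<le> k * (1 - \<epsilon> / 4)" using \<epsilon> by (simp add: k_def algebra_simps)
      moreover have "k * poly E x \<le> 1" using k E01[OF x1] by (intro mult_le_one) auto
      ultimately show ?thesis unfolding eq by linarith
    qed
  qed
qed

section \<open>Matrices and vectors\<close>

lemma dim_mat_adjoint [simp]: "dim_row (mat_adjoint A) = dim_col A" "dim_col (mat_adjoint A) = dim_row A"
  unfolding mat_adjoint_def by simp_all

lemma mat_adjoint_carrier [simp]: "A \<in> carrier_mat r c \<Longrightarrow> mat_adjoint A \<in> carrier_mat c r"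
  by (intro carrier_matI) auto

lemma index_mat_adjoint [simp]:
  fixes A :: "complex mat"
  assumes "i < dim_col A" "j < dim_row A"
  shows "mat_adjoint A $$ (i, j) = cnj (A $$ (j, i))"
  using assms unfolding mat_adjoint_def by (simp add: mat_of_rows_index)

lemma mat_adjoint_mult:
  fixes A B :: "complex mat"
  assumes "A \<in> carrier_mat r k" "B \<in> carrier_mat k c"
  shows "mat_adjoint (A * B) = mat_adjoint B * mat_adjoint A"
  by (rule eq_matI) (use assms in \<open>auto simp: scalar_prod_def mult.commute intro!: sum.cong\<close>)

lemma cscalar_prod_sum:
  fixes x y :: "complex vec"
  assumes "y \<in> carrier_vec n"
  shows "x \<bullet>c y = (\<Sum>b<n. x $ b * cnj (y $ b))"
  using assms by (auto simp: scalar_prod_def lessThan_atLeast0 intro!: sum.cong)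

lemma cscalar_prod_mult_mat:
  fixes A :: "complex mat"
  assumes "A \<in> carrier_mat n n" "x \<in> carrier_vec n" "y \<in> carrier_vec n"
  shows "(A *\<^sub>v x) \<bullet>c y = x \<bullet>c (mat_adjoint A *\<^sub>v y)"
proof -
  have "(A *\<^sub>v x) \<bullet>c y = (\<Sum>a<n. \<Sum>b<n. A $$ (a, b) * x $ b * cnj (y $ a))"
    using assms by (subst cscalar_prod_sum[of _ n])
      (auto simp: scalar_prod_def lessThan_atLeast0 sum_distrib_right intro!: sum.cong)
  also have "\<dots> = (\<Sum>b<n. \<Sum>a<n. A $$ (a, b) * x $ b * cnj (y $ a))" by (rule sum.swap)
  also have "\<dots> = x \<bullet>c (mat_adjoint A *\<^sub>v y)"
    using assms mult_mat_vec_carrier[OF mat_adjoint_carrier[OF assms(1)] assms(3)]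
    by (subst cscalar_prod_sum[of _ n])
      (auto simp: scalar_prod_def lessThan_atLeast0 sum_distrib_left intro!: sum.cong)
  finally show ?thesis .
qed

lemma eq_mat_mult_vecI:
  fixes A B :: "complex mat"
  assumes "A \<in> carrier_mat n n" "B \<in> carrier_mat n n"
    and "\<And>x. x \<in> carrier_vec n \<Longrightarrow> A *\<^sub>v x = B *\<^sub>v x"
  shows "A = B"
proof (rule eq_matI)
  fix i j assume ij: "i < dim_row B" "j < dim_col B"
  have "(A *\<^sub>v unit_vec n j) $ i = (B *\<^sub>v unit_vec n j) $ i" using assms by simp
  then show "A $$ (i, j) = B $$ (i, j)" using assms(1,2) ij by simp
qed (use assms in auto)

section \<open>Orthogonal projectors\<close>

lemma orth_projD:
  assumes "orth_proj n P"
  shows "P \<in> carrier_mat n n" "P * P = P" "mat_adjoint P = P"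
  using assms by (auto simp: orth_proj_def)

lemma orth_proj_mult_vec_img:
  assumes "orth_proj n P" "x \<in> mat_img n P"
  shows "P *\<^sub>v x = x" "x \<in> carrier_vec n"
proof -
  obtain y where y: "y \<in> carrier_vec n" "x = P *\<^sub>v y" using assms(2) by (auto simp: mat_img_def)
  note P = orth_projD[OF assms(1)]
  show "P *\<^sub>v x = x" unfolding y(2) by (subst assoc_mult_mat_vec[symmetric, OF P(1) P(1) y(1)]) (simp add: P)
  show "x \<in> carrier_vec n" using P y by simp
qed

text \<open>Equal images give \<open>P * Q = Q\<close> and \<open>Q * P = P\<close>, and these
  products are adjoint to each other. This makes the definite description in
  \<open>proj_onto\<close> usable.\<close>

lemma orth_proj_unique:
  assumes P: "orth_proj n P" and Q: "orth_proj n Q" and img: "mat_img n P = mat_img n Q"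
  shows "P = Q"
proof -
  note p = orth_projD[OF P] and q = orth_projD[OF Q]
  have "A * B = B" if A: "orth_proj n A" and B: "orth_proj n B" and "mat_img n A = mat_img n B" for A B
  proof (rule eq_mat_mult_vecI)
    note a = orth_projD[OF A] and b = orth_projD[OF B]
    show "A * B \<in> carrier_mat n n" "B \<in> carrier_mat n n" using a b by auto
    fix x :: "complex vec" assume x: "x \<in> carrier_vec n"
    have "B *\<^sub>v x \<in> mat_img n A" using x that(3) by (auto simp: mat_img_def)
    then show "A * B *\<^sub>v x = B *\<^sub>v x"
      using orth_proj_mult_vec_img[OF A] assoc_mult_mat_vec[OF a(1) b(1) x] by simp
  qed
  then have "P * Q = Q" "Q * P = P" using assms by auto
  moreover have "mat_adjoint (P * Q) = Q * P"
    using mat_adjoint_mult[OF p(1) q(1)] by (simp only: p q)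
  ultimately show ?thesis by (simp only: q)
qed

section \<open>Linear combinations and projectors onto spans\<close>

definition comb_vec :: "nat \<Rightarrow> (nat \<Rightarrow> complex) \<Rightarrow> (nat \<Rightarrow> complex vec) \<Rightarrow> nat set \<Rightarrow> complex vec" where
  "comb_vec n c f I = vec n (\<lambda>a. \<Sum>i\<in>I. c i * (f i $ a))"

lemma comb_vec_carrier [simp]: "comb_vec n c f I \<in> carrier_vec n"
  by (simp add: comb_vec_def)

lemma comb_vec_cong: "(\<And>i. i \<in> I \<Longrightarrow> c i = d i) \<Longrightarrow> comb_vec n c f I = comb_vec n d f I"
  by (simp add: comb_vec_def)

lemma lin_span_comb_vec: "lin_span n f I = range (\<lambda>c. comb_vec n c f I)"
  by (auto simp: lin_span_def comb_vec_def)

lemma mat_sum_carrier [simp]: "mat_sum n f I \<in> carrier_mat n n"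
  by (simp add: mat_sum_def)

lemma mat_sum_ket_bra_mult_vec:
  assumes f: "\<And>i. i \<in> I \<Longrightarrow> f i \<in> carrier_vec n" and g: "\<And>i. i \<in> I \<Longrightarrow> g i \<in> carrier_vec n"
    and x: "x \<in> carrier_vec n"
  shows "mat_sum n (\<lambda>i. c i \<cdot>\<^sub>m ket_bra (f i) (g i)) I *\<^sub>v x = comb_vec n (\<lambda>i. c i * (x \<bullet>c g i)) f I"
proof (rule eq_vecI)
  fix a assume "a < dim_vec (comb_vec n (\<lambda>i. c i * (x \<bullet>c g i)) f I)"
  then have a: "a < n" by (simp add: comb_vec_def)
  have "(mat_sum n (\<lambda>i. c i \<cdot>\<^sub>m ket_bra (f i) (g i)) I *\<^sub>v x) $ a
     = (\<Sum>b<n. (\<Sum>i\<in>I. (c i \<cdot>\<^sub>m ket_bra (f i) (g i)) $$ (a, b)) * x $ b)"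
    using a x by (auto simp: scalar_prod_def mat_sum_def lessThan_atLeast0 intro!: sum.cong)
  also have "\<dots> = (\<Sum>b<n. \<Sum>i\<in>I. c i * (x $ b * cnj (g i $ b)) * f i $ a)"
    unfolding sum_distrib_right
  proof (intro sum.cong refl)
    fix b i assume "b \<in> {..<n}" "i \<in> I"
    then show "(c i \<cdot>\<^sub>m ket_bra (f i) (g i)) $$ (a, b) * x $ b = c i * (x $ b * cnj (g i $ b)) * f i $ a"
      using a f[of i] g[of i] by (auto simp: ket_bra_def)
  qed
  also have "\<dots> = (\<Sum>i\<in>I. \<Sum>b<n. c i * (x $ b * cnj (g i $ b)) * f i $ a)" by (rule sum.swap)
  also have "\<dots> = (\<Sum>i\<in>I. c i * (x \<bullet>c g i) * f i $ a)"
    by (intro sum.cong refl) (simp add: cscalar_prod_sum[OF g] sum_distrib_left sum_distrib_right)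
  finally show "(mat_sum n (\<lambda>i. c i \<cdot>\<^sub>m ket_bra (f i) (g i)) I *\<^sub>v x) $ a
     = comb_vec n (\<lambda>i. c i * (x \<bullet>c g i)) f I $ a" using a by (simp add: comb_vec_def)
qed (simp add: mat_sum_def comb_vec_def)

lemma comb_vec_cscalar_prod:
  assumes "orthonormal_family n f k" "I \<subseteq> {..<k}" "j < k"
  shows "comb_vec n c f I \<bullet>c f j = (if j \<in> I then c j else 0)"
proof -
  have fin: "finite I" using assms(2) finite_subset by blast
  have f: "f i \<in> carrier_vec n" if "i < k" for i using assms(1) that by (simp add: orthonormal_family_def)
  have "comb_vec n c f I \<bullet>c f j = (\<Sum>b<n. \<Sum>i\<in>I. c i * (f i $ b * cnj (f j $ b)))"
    by (subst cscalar_prod_sum[OF f[OF assms(3)]])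
       (auto simp: comb_vec_def sum_distrib_right mult.assoc intro!: sum.cong)
  also have "\<dots> = (\<Sum>i\<in>I. \<Sum>b<n. c i * (f i $ b * cnj (f j $ b)))" by (rule sum.swap)
  also have "\<dots> = (\<Sum>i\<in>I. c i * (f i \<bullet>c f j))"
    by (simp add: cscalar_prod_sum[OF f[OF assms(3)]] sum_distrib_left)
  also have "\<dots> = (\<Sum>i\<in>I. if i = j then c i else 0)"
    using assms by (intro sum.cong) (auto simp: orthonormal_family_def)
  finally show ?thesis using fin by simp
qed

lemma comb_vec_delta:
  assumes "finite I" "j \<in> I \<Longrightarrow> f j \<in> carrier_vec n"
  shows "comb_vec n (\<lambda>i. if i = j then c else 0) f I = (if j \<in> I then c \<cdot>\<^sub>v f j else 0\<^sub>v n)"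
proof -
  have "(\<Sum>i\<in>I. (if i = j then c else 0) * f i $ a) = (\<Sum>i\<in>I. if i = j then c * f j $ a else 0)" for a
    by (rule sum.cong) auto
  then show ?thesis using assms by (intro eq_vecI) (auto simp: comb_vec_def)
qed

text \<open>The factor 1 brings the sum into the weighted form of
  \<open>mat_sum_ket_bra_mult_vec\<close>.\<close>

definition span_proj :: "nat \<Rightarrow> (nat \<Rightarrow> complex vec) \<Rightarrow> nat set \<Rightarrow> complex mat" where
  "span_proj n f I = mat_sum n (\<lambda>i. 1 \<cdot>\<^sub>m ket_bra (f i) (f i)) I"

lemma span_proj_carrier [simp]: "span_proj n f I \<in> carrier_mat n n"
  by (simp add: span_proj_def)

text \<open>Orthonormality makes the explicit sum fix every vector of the span, so it is idempotent
  with the right image; its entries show that it is self-adjoint. \<open>orth_proj_unique\<close>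
  then identifies it with \<open>proj_onto\<close>.\<close>

lemma proj_onto_lin_span:
  assumes on: "orthonormal_family n f k" and I: "I \<subseteq> {..<k}"
  shows "proj_onto n (lin_span n f I) = span_proj n f I"
    and "\<And>x. x \<in> carrier_vec n \<Longrightarrow> span_proj n f I *\<^sub>v x = comb_vec n (\<lambda>i. x \<bullet>c f i) f I"
    and "\<And>j. j \<in> I \<Longrightarrow> span_proj n f I *\<^sub>v f j = f j"
proof -
  let ?Q = "span_proj n f I"
  have fin: "finite I" using I finite_subset by blast
  have f: "f i \<in> carrier_vec n" if "i \<in> I" for i using on I that by (auto simp: orthonormal_family_def)
  show ev: "?Q *\<^sub>v x = comb_vec n (\<lambda>i. x \<bullet>c f i) f I" if "x \<in> carrier_vec n" for x
    unfolding span_proj_def using mat_sum_ket_bra_mult_vec[of I f n f x "\<lambda>_. 1"] f that by simp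
  have fix': "?Q *\<^sub>v comb_vec n c f I = comb_vec n c f I" for c
    unfolding ev[OF comb_vec_carrier]
    by (rule comb_vec_cong) (use comb_vec_cscalar_prod[OF on I] I in auto)
  show "?Q *\<^sub>v f j = f j" if "j \<in> I" for j
  proof -
    have "comb_vec n (\<lambda>i. if i = j then 1 else 0) f I = f j"
      using comb_vec_delta[of I j f n 1] fin f[OF that] that by simp
    then show ?thesis using fix'[of "\<lambda>i. if i = j then 1 else 0"] by (simp only:)
  qed
  have img: "mat_img n ?Q = lin_span n f I"
    unfolding mat_img_def lin_span_comb_vec
  proof safe
    fix x :: "complex vec" assume "x \<in> carrier_vec n"
    then show "?Q *\<^sub>v x \<in> range (\<lambda>c. comb_vec n c f I)" by (simp add: ev)
  next
    fix c show "\<exists>x. comb_vec n c f I = ?Q *\<^sub>v x \<and> x \<in> carrier_vec n"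
      by (rule exI[of _ "comb_vec n c f I"]) (simp add: fix')
  qed
  have "?Q * ?Q = ?Q"
  proof (rule eq_mat_mult_vecI)
    fix x :: "complex vec" assume x: "x \<in> carrier_vec n"
    then show "?Q * ?Q *\<^sub>v x = ?Q *\<^sub>v x"
      using fix'[of "\<lambda>i. x \<bullet>c f i"] assoc_mult_mat_vec[OF span_proj_carrier span_proj_carrier x, of f I f I]
      by (simp only: ev[OF x])
  qed (simp_all add: mult_carrier_mat[OF span_proj_carrier span_proj_carrier])
  moreover have "mat_adjoint ?Q = ?Q"
  proof (rule eq_matI)
    fix i j assume "i < dim_row ?Q" "j < dim_col ?Q"
    then have ij: "i < n" "j < n" by (auto simp: span_proj_def mat_sum_def)
    then have "mat_adjoint ?Q $$ (i, j) = cnj (?Q $$ (j, i))"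
      by (subst index_mat_adjoint) (auto simp: span_proj_def mat_sum_def)
    also have "\<dots> = ?Q $$ (i, j)"
      using ij by (auto simp: span_proj_def mat_sum_def ket_bra_def carrier_vecD[OF f] mult.commute intro!: sum.cong)
    finally show "mat_adjoint ?Q $$ (i, j) = ?Q $$ (i, j)" .
  qed (auto simp: span_proj_def mat_sum_def)
  ultimately have proj: "orth_proj n ?Q" by (simp add: orth_proj_def)
  show "proj_onto n (lin_span n f I) = ?Q"
    unfolding proj_onto_def
  proof (rule the_equality)
    show "orth_proj n ?Q \<and> mat_img n ?Q = lin_span n f I" using proj img ..
    fix R assume "orth_proj n R \<and> mat_img n R = lin_span n f I"
    then show "R = ?Q" using orth_proj_unique[OF _ proj, of R] img by simp
  qed
qed

text \<open>Reduces a matrix composed with such a projector to its action on the single vectors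
  \<open>f i\<close>.\<close>

lemma mult_span_proj:
  assumes A: "A \<in> carrier_mat n n" and f: "\<And>i. i \<in> I \<Longrightarrow> f i \<in> carrier_vec n"
  shows "A * span_proj n f I = mat_sum n (\<lambda>i. ket_bra (A *\<^sub>v f i) (f i)) I"
proof (rule eq_matI)
  fix a b assume "a < dim_row (mat_sum n (\<lambda>i. ket_bra (A *\<^sub>v f i) (f i)) I)"
    "b < dim_col (mat_sum n (\<lambda>i. ket_bra (A *\<^sub>v f i) (f i)) I)"
  then have ab: "a < n" "b < n" by (auto simp: mat_sum_def)
  have "(A * span_proj n f I) $$ (a, b) = (\<Sum>k<n. \<Sum>i\<in>I. A $$ (a, k) * f i $ k * cnj (f i $ b))"
    using A ab f
    by (auto simp: scalar_prod_def span_proj_def mat_sum_def lessThan_atLeast0 sum_distrib_left ket_bra_def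
        carrier_vecD[OF f] mult.assoc intro!: sum.cong)
  also have "\<dots> = (\<Sum>i\<in>I. \<Sum>k<n. A $$ (a, k) * f i $ k * cnj (f i $ b))" by (rule sum.swap)
  also have "\<dots> = mat_sum n (\<lambda>i. ket_bra (A *\<^sub>v f i) (f i)) I $$ (a, b)"
    using A ab
    by (auto simp: scalar_prod_def mat_sum_def lessThan_atLeast0 sum_distrib_right ket_bra_def
        carrier_vecD[OF f] intro!: sum.cong)
  finally show "(A * span_proj n f I) $$ (a, b) = mat_sum n (\<lambda>i. ket_bra (A *\<^sub>v f i) (f i)) I $$ (a, b)" .
qed (use A in \<open>auto simp: mat_sum_def span_proj_def\<close>)

section \<open>Exponentials of reflections\<close>

lemma one_minus_carrier_mat [simp]: "1\<^sub>m n - P \<in> carrier_mat n n" if "P \<in> carrier_mat n n"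
  for P :: "complex mat"
  using that by (simp add: minus_carrier_mat)

text \<open>For a projector \<open>P\<close>: the matrix with eigenvalue \<open>a\<close> on the
  image of \<open>P\<close> and \<open>b\<close> on the complement. This family is closed under
  products and contains the reflection, its powers and its exponential.\<close>

definition phase_mat :: "nat \<Rightarrow> complex mat \<Rightarrow> complex \<Rightarrow> complex \<Rightarrow> complex mat" where
  "phase_mat n P a b = a \<cdot>\<^sub>m P + b \<cdot>\<^sub>m (1\<^sub>m n - P)"

lemma phase_mat_mult_vec:
  assumes P: "P \<in> carrier_mat n n" and x: "x \<in> carrier_vec n"
  shows "phase_mat n P a b *\<^sub>v x = a \<cdot>\<^sub>v (P *\<^sub>v x) + b \<cdot>\<^sub>v (x - P *\<^sub>v x)"
proof -
  have "phase_mat n P a b *\<^sub>v x = (a \<cdot>\<^sub>m P) *\<^sub>v x + (b \<cdot>\<^sub>m (1\<^sub>m n - P)) *\<^sub>v x"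
    unfolding phase_mat_def using P x by (intro add_mult_distrib_mat_vec) auto
  moreover have "(c \<cdot>\<^sub>m A) *\<^sub>v x = c \<cdot>\<^sub>v (A *\<^sub>v x)" if "A \<in> carrier_mat n n" for c and A :: "complex mat"
    using that x by (intro eq_vecI) (auto simp: scalar_prod_def sum_distrib_left mult.assoc)
  moreover have "(1\<^sub>m n - P) *\<^sub>v x = x - P *\<^sub>v x"
    using minus_mult_distrib_mat_vec[of "1\<^sub>m n" n n P x] P x by simp
  ultimately show ?thesis using P by simp
qed

lemma phase_mat_mult:
  assumes P: "orth_proj n P"
  shows "phase_mat n P a b * phase_mat n P c d = phase_mat n P (a * c) (b * d)"
proof (rule eq_mat_mult_vecI)
  note p = orth_projD[OF P]
  have car: "phase_mat n P a b \<in> carrier_mat n n" for a b using p by (simp add: phase_mat_def)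
  then show "phase_mat n P a b * phase_mat n P c d \<in> carrier_mat n n"
    "phase_mat n P (a * c) (b * d) \<in> carrier_mat n n" by (auto intro: mult_carrier_mat)
  fix x :: "complex vec" assume x: "x \<in> carrier_vec n"
  define y where "y = P *\<^sub>v x"
  have y: "y \<in> carrier_vec n" "P *\<^sub>v y = y"
    using p x assoc_mult_mat_vec[OF p(1) p(1) x] by (auto simp: y_def)
  define z where "z = c \<cdot>\<^sub>v y + d \<cdot>\<^sub>v (x - y)"
  have z: "z \<in> carrier_vec n" using x y by (simp add: z_def)
  have "P *\<^sub>v z = c \<cdot>\<^sub>v y + d \<cdot>\<^sub>v (y - y)"
    unfolding z_def using p x y
    by (simp add: mult_add_distrib_mat_vec[of _ n n] mult_mat_vec[of _ n n] mult_minus_distrib_mat_vec[of _ n n] y_def[symmetric])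
  then have Pz: "P *\<^sub>v z = c \<cdot>\<^sub>v y" using y by (intro eq_vecI) auto
  have "phase_mat n P a b * phase_mat n P c d *\<^sub>v x = phase_mat n P a b *\<^sub>v z"
    using assoc_mult_mat_vec[OF car car x] phase_mat_mult_vec[OF p(1) x] by (simp add: z_def y_def)
  also have "\<dots> = a \<cdot>\<^sub>v (c \<cdot>\<^sub>v y) + b \<cdot>\<^sub>v (z - c \<cdot>\<^sub>v y)" using phase_mat_mult_vec[OF p(1) z] Pz by simp
  also have "\<dots> = (a * c) \<cdot>\<^sub>v y + (b * d) \<cdot>\<^sub>v (x - y)"
    using x y by (intro eq_vecI) (auto simp: z_def algebra_simps)
  also have "\<dots> = phase_mat n P (a * c) (b * d) *\<^sub>v x" using phase_mat_mult_vec[OF p(1) x] by (simp add: y_def)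
  finally show "phase_mat n P a b * phase_mat n P c d *\<^sub>v x = phase_mat n P (a * c) (b * d) *\<^sub>v x" .
qed

text \<open>The exponent is the phase matrix with eigenvalues \<open>z\<close> and
  \<open>-z\<close>, where \<open>z\<close> is \<open>\<i>\<close> times \<open>\<phi>\<close>. Its
  powers are phase matrices, so each entry of the series combines two scalar exponential
  series.\<close>

lemma refl_exp_eq_phase_mat:
  assumes P: "orth_proj n P"
  shows "refl_exp n P \<phi> = phase_mat n P (cis \<phi>) (cis (- \<phi>))"
proof -
  note p = orth_projD[OF P]
  define z where "z = \<i> * complex_of_real \<phi>"
  define X where "X = z \<cdot>\<^sub>m (2 \<cdot>\<^sub>m P - 1\<^sub>m n)"
  have X: "X = phase_mat n P z (- z)"
    unfolding X_def phase_mat_def using p by (intro eq_matI) (auto simp: algebra_simps)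
  have one: "phase_mat n P 1 1 = 1\<^sub>m n"
    unfolding phase_mat_def using p by (intro eq_matI) auto
  have dim: "dim_row X = n" "dim_col X = n" using p by (auto simp: X_def)
  have pow: "X ^\<^sub>m k = phase_mat n P (z ^ k) ((- z) ^ k)" for k
    by (induction k) (auto simp: one dim(1)[unfolded X] X phase_mat_mult[OF P] mult.commute)
  have exp: "(\<lambda>k. w ^ k / fact k) sums exp w" for w :: complex
    using exp_converges[of w] by (simp add: scaleR_conv_of_real divide_inverse mult.commute)
  show ?thesis
  proof (rule eq_matI)
    fix a b assume "a < dim_row (phase_mat n P (cis \<phi>) (cis (- \<phi>)))" "b < dim_col (phase_mat n P (cis \<phi>) (cis (- \<phi>)))"
    then have ab: "a < n" "b < n" using p by (auto simp: phase_mat_def)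
    have entry: "phase_mat n P u w $$ (a, b) = u * P $$ (a, b) + w * (1\<^sub>m n - P) $$ (a, b)" for u w
      using ab p by (simp add: phase_mat_def)
    have "(\<lambda>k. z ^ k / fact k * P $$ (a, b) + (- z) ^ k / fact k * (1\<^sub>m n - P) $$ (a, b)) sums
        (exp z * P $$ (a, b) + exp (- z) * (1\<^sub>m n - P) $$ (a, b))"
      by (intro sums_add sums_mult2 exp)
    then have "(\<lambda>k. (X ^\<^sub>m k) $$ (a, b) / of_nat (fact k)) sums phase_mat n P (exp z) (exp (- z)) $$ (a, b)"
      unfolding pow entry by (simp add: add_divide_distrib)
    then have "(\<Sum>k. (X ^\<^sub>m k) $$ (a, b) / of_nat (fact k)) = phase_mat n P (exp z) (exp (- z)) $$ (a, b)"
      by (rule sums_unique[symmetric])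
    then show "refl_exp n P \<phi> $$ (a, b) = phase_mat n P (cis \<phi>) (cis (- \<phi>)) $$ (a, b)"
      using ab dim by (simp add: refl_exp_def mat_exp_def X_def[symmetric] z_def[symmetric])
        (simp add: z_def cis_conv_exp)
  qed (use dim p in \<open>auto simp: refl_exp_def mat_exp_def X_def[symmetric] z_def[symmetric] phase_mat_def\<close>)
qed

lemma refl_exp_carrier:
  assumes "orth_proj n P" shows "refl_exp n P \<phi> \<in> carrier_mat n n"
  using orth_projD[OF assms] unfolding refl_exp_eq_phase_mat[OF assms] by (simp add: phase_mat_def)

lemma refl_exp_mult_vec:
  assumes P: "orth_proj n P" and x: "x \<in> carrier_vec n" "P *\<^sub>v x = x" and y: "y \<in> carrier_vec n" "P *\<^sub>v y = 0\<^sub>v n"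
  shows "refl_exp n P \<phi> *\<^sub>v (a \<cdot>\<^sub>v x + b \<cdot>\<^sub>v y) = (cis \<phi> * a) \<cdot>\<^sub>v x + (cis (- \<phi>) * b) \<cdot>\<^sub>v y"
proof -
  note p = orth_projD[OF P]
  let ?u = "a \<cdot>\<^sub>v x + b \<cdot>\<^sub>v y"
  have "P *\<^sub>v ?u = a \<cdot>\<^sub>v x + b \<cdot>\<^sub>v 0\<^sub>v n"
    using p x y by (simp add: mult_add_distrib_mat_vec[of _ n n] mult_mat_vec[of _ n n])
  then have "P *\<^sub>v ?u = a \<cdot>\<^sub>v x" using x by (intro eq_vecI) auto
  then have "refl_exp n P \<phi> *\<^sub>v ?u = cis \<phi> \<cdot>\<^sub>v (a \<cdot>\<^sub>v x) + cis (- \<phi>) \<cdot>\<^sub>v (?u - a \<cdot>\<^sub>v x)"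
    unfolding refl_exp_eq_phase_mat[OF P] using phase_mat_mult_vec[OF p(1), of ?u] x y by simp
  also have "\<dots> = (cis \<phi> * a) \<cdot>\<^sub>v x + (cis (- \<phi>) * b) \<cdot>\<^sub>v y"
    using x y by (intro eq_vecI) (auto simp: algebra_simps)
  finally show ?thesis .
qed

section \<open>Singular value transformation\<close>

lemma U_Phi_singleton:
  assumes "orth_proj n Pt" "U \<in> carrier_mat n n"
  shows "U_Phi n U P Pt [\<phi>] = refl_exp n Pt \<phi> * U"
  using refl_exp_carrier[OF assms(1), of \<phi>] assms(2) by (simp add: U_Phi_def mat_prod_list_def)

lemma mat_prod_list_carrier:
  assumes "\<And>A. A \<in> set As \<Longrightarrow> A \<in> carrier_mat n n"
  shows "mat_prod_list n As \<in> carrier_mat n n"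
  using assms by (induction As) (auto simp: mat_prod_list_def intro!: mult_carrier_mat)

text \<open>Turns the indexed product into a recursion on the list: the factor \<open>j = 1\<close>
  supplies the leading phase of the shorter product, and the later factors shift their index by
  one.\<close>

lemma U_Phi_Cons_Cons:
  assumes P: "orth_proj n P" and Pt: "orth_proj n Pt" and U: "U \<in> carrier_mat n n"
    and len: "odd (length \<Phi>)"
  shows "U_Phi n U P Pt (\<phi> # \<psi> # \<Phi>) =
    refl_exp n Pt \<phi> * U * (refl_exp n P \<psi> * mat_adjoint U * U_Phi n U P Pt \<Phi>)"
    and "U_Phi n U P Pt \<Phi> \<in> carrier_mat n n"
proof -
  note c = refl_exp_carrier[OF P] refl_exp_carrier[OF Pt] U mat_adjoint_carrier[OF U]
  obtain l where l: "length \<Phi> = 2 * l + 1" using len by (elim oddE)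
  define W where "W \<Phi> j = refl_exp n P (\<Phi> ! (2*j - 1)) * mat_adjoint U *
                               refl_exp n Pt (\<Phi> ! (2*j)) * U" for \<Phi> :: "real list" and j
  define R where "R = mat_prod_list n (map (W \<Phi>) [1..<l + 1])"
  have R: "R \<in> carrier_mat n n"
    unfolding R_def W_def using c by (intro mat_prod_list_carrier) (auto intro!: mult_carrier_mat)
  have \<Phi>: "U_Phi n U P Pt \<Phi> = refl_exp n Pt (\<Phi> ! 0) * U * R"
    by (simp add: U_Phi_def R_def W_def[abs_def] l)
  show "U_Phi n U P Pt \<Phi> \<in> carrier_mat n n" unfolding \<Phi> using c R by (auto intro!: mult_carrier_mat)
  have upt: "[1..<l + 2] = 1 # map Suc [1..<l + 1]"
    by (simp add: upt_conv_Cons map_Suc_upt)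
  \<comment> \<open>\<open>j \<ge> 1\<close> keeps \<open>2*j - 1\<close> from being truncated at
    0.\<close>
  have step: "W (\<phi> # \<psi> # \<Phi>) (Suc j) = W \<Phi> j" if "j \<ge> 1" for j
  proof -
    obtain i where "j = Suc i" using \<open>j \<ge> 1\<close> by (cases j) auto
    then show ?thesis by (simp add: W_def)
  qed
  have first: "W (\<phi> # \<psi> # \<Phi>) 1 = refl_exp n P \<psi> * mat_adjoint U * refl_exp n Pt (\<Phi> ! 0) * U"
    by (simp add: W_def numeral_2_eq_2)
  have "map (W (\<phi> # \<psi> # \<Phi>)) [1..<l + 2] =
      (refl_exp n P \<psi> * mat_adjoint U * refl_exp n Pt (\<Phi> ! 0) * U) # map (W \<Phi>) [1..<l + 1]"
    unfolding upt list.map first list.inject map_map by (auto simp: step simp del: upt_Suc)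
  then have "mat_prod_list n (map (W (\<phi> # \<psi> # \<Phi>)) [1..<l + 2]) =
      refl_exp n P \<psi> * mat_adjoint U * refl_exp n Pt (\<Phi> ! 0) * U * R"
    unfolding R_def by (simp only: mat_prod_list_def list.map foldr.simps o_apply)
  also have "\<dots> = refl_exp n P \<psi> * mat_adjoint U * U_Phi n U P Pt \<Phi>"
  proof -
    note X = mult_carrier_mat[OF c(1) c(4)]
    show ?thesis unfolding \<Phi>
      by (simp only: assoc_mult_mat[OF X c(2) U] assoc_mult_mat[OF X mult_carrier_mat[OF c(2) U] R])
  qed
  finally show "U_Phi n U P Pt (\<phi> # \<psi> # \<Phi>) =
    refl_exp n Pt \<phi> * U * (refl_exp n P \<psi> * mat_adjoint U * U_Phi n U P Pt \<Phi>)"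
    by (simp add: U_Phi_def W_def[abs_def] l)
qed

text \<open>One block of Jordan's lemma on two projectors: \<open>U\<close> maps the plane of
  \<open>v, v'\<close> to that of \<open>w, w'\<close> by \<open>R(x)\<close>, and
  \<open>mat_adjoint U\<close> maps back by the same matrix. Lengths are left open, so that vectors
  may be zero in degenerate blocks.\<close>

definition two_level :: "nat \<Rightarrow> complex mat \<Rightarrow> complex mat \<Rightarrow> complex mat \<Rightarrow> real \<Rightarrow>
    complex vec \<Rightarrow> complex vec \<Rightarrow> complex vec \<Rightarrow> complex vec \<Rightarrow> bool" where
  "two_level n U P Pt x v v' w w' \<longleftrightarrow>
    v \<in> carrier_vec n \<and> v' \<in> carrier_vec n \<and> w \<in> carrier_vec n \<and> w' \<in> carrier_vec n \<and>
    P *\<^sub>v v = v \<and> P *\<^sub>v v' = 0\<^sub>v n \<and> Pt *\<^sub>v w = w \<and> Pt *\<^sub>v w' = 0\<^sub>v n \<and>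
    (let c = complex_of_real x; s = complex_of_real (sqrt (1 - x\<^sup>2)) in
      U *\<^sub>v v = c \<cdot>\<^sub>v w + s \<cdot>\<^sub>v w' \<and> U *\<^sub>v v' = s \<cdot>\<^sub>v w - c \<cdot>\<^sub>v w' \<and>
      mat_adjoint U *\<^sub>v w = c \<cdot>\<^sub>v v + s \<cdot>\<^sub>v v' \<and> mat_adjoint U *\<^sub>v w' = s \<cdot>\<^sub>v v - c \<cdot>\<^sub>v v')"

lemma two_level_step:
  fixes A :: "complex mat"
  assumes A: "A \<in> carrier_mat n n" and v: "v \<in> carrier_vec n" "v' \<in> carrier_vec n"
    and w: "w \<in> carrier_vec n" "w' \<in> carrier_vec n"
    and 1: "A *\<^sub>v v = c \<cdot>\<^sub>v w + s \<cdot>\<^sub>v w'" and 2: "A *\<^sub>v v' = s \<cdot>\<^sub>v w - c \<cdot>\<^sub>v w'"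
  shows "A *\<^sub>v (a \<cdot>\<^sub>v v + b \<cdot>\<^sub>v v') = (c * a + s * b) \<cdot>\<^sub>v w + (s * a - c * b) \<cdot>\<^sub>v w'"
proof -
  have "A *\<^sub>v (a \<cdot>\<^sub>v v + b \<cdot>\<^sub>v v') = a \<cdot>\<^sub>v (c \<cdot>\<^sub>v w + s \<cdot>\<^sub>v w') + b \<cdot>\<^sub>v (s \<cdot>\<^sub>v w - c \<cdot>\<^sub>v w')"
    using A v by (simp add: mult_add_distrib_mat_vec[of _ n n] mult_mat_vec[of _ n n] 1 2)
  also have "\<dots> = (c * a + s * b) \<cdot>\<^sub>v w + (s * a - c * b) \<cdot>\<^sub>v w'"
    using w by (intro eq_vecI) (auto simp: algebra_simps)
  finally show ?thesis .
qed

text \<open>\<open>U\<close> and \<open>mat_adjoint U\<close> both act by \<open>R(x)\<close>, and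
  the exponentials by the same diagonal phases, so each phase of the list is one step of
  \<open>qsp\<close>. The odd length makes the result land in the plane of
  \<open>w, w'\<close>.\<close>

lemma U_Phi_two_level:
  assumes P: "orth_proj n P" and Pt: "orth_proj n Pt" and U: "U \<in> carrier_mat n n"
    and t: "two_level n U P Pt x v v' w w'"
    and len: "odd (length \<Phi>)"
  shows "U_Phi n U P Pt \<Phi> *\<^sub>v v = fst (qsp \<Phi> x) \<cdot>\<^sub>v w + snd (qsp \<Phi> x) \<cdot>\<^sub>v w'"
  using len
proof (induction "length \<Phi>" arbitrary: \<Phi> rule: less_induct)
  case less
  let ?c = "complex_of_real x" and ?s = "complex_of_real (sqrt (1 - x\<^sup>2))"
  have v: "v \<in> carrier_vec n" "v' \<in> carrier_vec n" and w: "w \<in> carrier_vec n" "w' \<in> carrier_vec n"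
    and Pv: "P *\<^sub>v v = v" "P *\<^sub>v v' = 0\<^sub>v n" and Pw: "Pt *\<^sub>v w = w" "Pt *\<^sub>v w' = 0\<^sub>v n"
    and Uv: "U *\<^sub>v v = ?c \<cdot>\<^sub>v w + ?s \<cdot>\<^sub>v w'" "U *\<^sub>v v' = ?s \<cdot>\<^sub>v w - ?c \<cdot>\<^sub>v w'"
    and Uw: "mat_adjoint U *\<^sub>v w = ?c \<cdot>\<^sub>v v + ?s \<cdot>\<^sub>v v'" "mat_adjoint U *\<^sub>v w' = ?s \<cdot>\<^sub>v v - ?c \<cdot>\<^sub>v v'"
    using t by (auto simp: two_level_def Let_def)
  note U' = mat_adjoint_carrier[OF U]
  note R = refl_exp_carrier[OF P] and Rt = refl_exp_carrier[OF Pt]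
  have fwd: "refl_exp n Pt \<phi> * U *\<^sub>v (a \<cdot>\<^sub>v v + b \<cdot>\<^sub>v v') =
      (cis \<phi> * (?c * a + ?s * b)) \<cdot>\<^sub>v w + (cis (- \<phi>) * (?s * a - ?c * b)) \<cdot>\<^sub>v w'" for \<phi> a b
    using assoc_mult_mat_vec[OF Rt U, of "a \<cdot>\<^sub>v v + b \<cdot>\<^sub>v v'" \<phi>] v
      two_level_step[OF U v w Uv] refl_exp_mult_vec[OF Pt w(1) Pw(1) w(2) Pw(2)] by simp
  have bwd: "refl_exp n P \<phi> * mat_adjoint U *\<^sub>v (a \<cdot>\<^sub>v w + b \<cdot>\<^sub>v w') =
      (cis \<phi> * (?c * a + ?s * b)) \<cdot>\<^sub>v v + (cis (- \<phi>) * (?s * a - ?c * b)) \<cdot>\<^sub>v v'" for \<phi> a b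
    using assoc_mult_mat_vec[OF R U', of "a \<cdot>\<^sub>v w + b \<cdot>\<^sub>v w'" \<phi>] w
      two_level_step[OF U' w v Uw] refl_exp_mult_vec[OF P v(1) Pv(1) v(2) Pv(2)] by simp
  show ?case
  proof (cases "length \<Phi> = 1")
    case True
    then obtain \<phi> where \<Phi>: "\<Phi> = [\<phi>]" by (auto simp: length_Suc_conv)
    have "1 \<cdot>\<^sub>v v + 0 \<cdot>\<^sub>v v' = v" using v by (intro eq_vecI) auto
    then show ?thesis using fwd[of \<phi> 1 0] unfolding \<Phi> U_Phi_singleton[OF Pt U] by simp
  next
    case False
    with less.prems obtain \<phi> \<psi> \<Psi> where \<Phi>: "\<Phi> = \<phi> # \<psi> # \<Psi>"
      by (cases \<Phi>; cases "tl \<Phi>") auto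
    have odd: "odd (length \<Psi>)" using less.prems \<Phi> by simp
    note C = U_Phi_Cons_Cons[OF P Pt U odd]
    have "U_Phi n U P Pt \<Phi> *\<^sub>v v =
      refl_exp n Pt \<phi> * U *\<^sub>v (refl_exp n P \<psi> * mat_adjoint U *\<^sub>v (U_Phi n U P Pt \<Psi> *\<^sub>v v))"
      unfolding \<Phi> C(1)
      using assoc_mult_mat_vec[OF mult_carrier_mat[OF Rt U] mult_carrier_mat[OF mult_carrier_mat[OF R U'] C(2)] v(1)]
        assoc_mult_mat_vec[OF mult_carrier_mat[OF R U'] C(2) v(1)] by simp
    also have "U_Phi n U P Pt \<Psi> *\<^sub>v v = fst (qsp \<Psi> x) \<cdot>\<^sub>v w + snd (qsp \<Psi> x) \<cdot>\<^sub>v w'"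
      using less.hyps[of \<Psi>] odd \<Phi> by simp
    finally show ?thesis unfolding bwd fwd by (simp add: \<Phi>)
  qed
qed

lemma unitary_matD:
  assumes "unitary_mat n U"
  shows "U \<in> carrier_mat n n" "x \<in> carrier_vec n \<Longrightarrow> mat_adjoint U *\<^sub>v (U *\<^sub>v x) = x"
    "x \<in> carrier_vec n \<Longrightarrow> U *\<^sub>v (mat_adjoint U *\<^sub>v x) = x"
proof -
  have U: "U \<in> carrier_mat n n" and 1: "mat_adjoint U * U = 1\<^sub>m n" "U * mat_adjoint U = 1\<^sub>m n"
    using assms by (auto simp: unitary_mat_def)
  show "U \<in> carrier_mat n n" by (fact U)
  note U' = mat_adjoint_carrier[OF U]
  show "mat_adjoint U *\<^sub>v (U *\<^sub>v x) = x" if "x \<in> carrier_vec n"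
    using assoc_mult_mat_vec[OF U' U that] 1 that by simp
  show "U *\<^sub>v (mat_adjoint U *\<^sub>v x) = x" if "x \<in> carrier_vec n"
    using assoc_mult_mat_vec[OF U U' that] 1 that by simp
qed

text \<open>\<open>v'\<close> and \<open>w'\<close> are the rescaled remainders of
  \<open>mat_adjoint U *\<^sub>v w\<close> and \<open>U *\<^sub>v v\<close> after removing
  \<open>x\<close> times \<open>v\<close> and \<open>w\<close>; the condition \<open>x < 1\<close>
  makes the scale nonzero.\<close>

lemma two_level_of_singular_pair:
  assumes unit: "unitary_mat n U" and P: "orth_proj n P" and Pt: "orth_proj n Pt"
    and v: "v \<in> carrier_vec n" "P *\<^sub>v v = v" and w: "w \<in> carrier_vec n" "Pt *\<^sub>v w = w"
    and x: "0 \<le> x" "x < 1"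
    and Uv: "Pt *\<^sub>v (U *\<^sub>v v) = complex_of_real x \<cdot>\<^sub>v w"
    and Uw: "P *\<^sub>v (mat_adjoint U *\<^sub>v w) = complex_of_real x \<cdot>\<^sub>v v"
  shows "\<exists>v' w'. two_level n U P Pt x v v' w w'"
proof -
  define c where "c = complex_of_real x"
  define s where "s = complex_of_real (sqrt (1 - x\<^sup>2))"
  note U = unitary_matD[OF unit]
  note U' = mat_adjoint_carrier[OF U(1)]
  note p = orth_projD[OF P] and q = orth_projD[OF Pt]
  have x2: "x\<^sup>2 < 1" using x by (simp add: power_less_one_iff abs_square_less_1)
  then have s0: "s \<noteq> 0" by (simp add: s_def)
  have "s * s = complex_of_real (sqrt (1 - x\<^sup>2) * sqrt (1 - x\<^sup>2))"
    by (simp only: s_def of_real_mult)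
  also have "\<dots> = complex_of_real (1 - x\<^sup>2)" using x2 by simp
  finally have ss: "s * s = 1 - c * c" by (simp add: c_def power2_eq_square)
  define comp where "comp y z = (1 / s) \<cdot>\<^sub>v (y - c \<cdot>\<^sub>v z)" for y z :: "complex vec"
  have comp: "comp y z \<in> carrier_vec n" if "y \<in> carrier_vec n" "z \<in> carrier_vec n" for y z
    using that by (simp add: comp_def)
  have dec: "y = c \<cdot>\<^sub>v z + s \<cdot>\<^sub>v comp y z" if "y \<in> carrier_vec n" "z \<in> carrier_vec n" for y z
    using that s0 by (intro eq_vecI) (auto simp: comp_def)
  have lin: "A *\<^sub>v comp y z = comp (A *\<^sub>v y) (A *\<^sub>v z)"
    if "A \<in> carrier_mat n n" "y \<in> carrier_vec n" "z \<in> carrier_vec n" for A y z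
    using that by (simp add: comp_def mult_mat_vec[of _ n n] mult_minus_distrib_mat_vec[of _ n n])
  have zero: "comp (c \<cdot>\<^sub>v z) z = 0\<^sub>v n" if "z \<in> carrier_vec n" for z
    using that by (intro eq_vecI) (auto simp: comp_def)
  \<comment> \<open>A consequence of \<open>s^2 = 1 - c^2\<close>. For
    \<open>y = U *\<^sub>v v\<close> and \<open>z = w\<close> it gives the action of
    \<open>U\<close> on \<open>v'\<close>, and likewise for the adjoint.\<close>
  have swap: "comp z y = s \<cdot>\<^sub>v z - c \<cdot>\<^sub>v comp y z" if "y \<in> carrier_vec n" "z \<in> carrier_vec n" for y z
  proof (rule eq_vecI)
    fix i assume "i < dim_vec (s \<cdot>\<^sub>v z - c \<cdot>\<^sub>v comp y z)"
    then have i: "i < n" using that by (simp add: comp_def)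
    have "z $ i - c * y $ i = s * s * z $ i - c * (y $ i - c * z $ i)"
      unfolding ss by (simp add: algebra_simps)
    then have "(z $ i - c * y $ i) / s = s * z $ i - c * ((y $ i - c * z $ i) / s)"
      using s0 by (simp add: field_simps)
    then show "comp z y $ i = (s \<cdot>\<^sub>v z - c \<cdot>\<^sub>v comp y z) $ i" using that i by (simp add: comp_def)
  qed (use that in \<open>auto simp: comp_def\<close>)
  have car: "U *\<^sub>v v \<in> carrier_vec n" "mat_adjoint U *\<^sub>v w \<in> carrier_vec n"
    by (rule mult_mat_vec_carrier[OF U(1) v(1)], rule mult_mat_vec_carrier[OF U' w(1)])
  have "two_level n U P Pt x v (comp (mat_adjoint U *\<^sub>v w) v) w (comp (U *\<^sub>v v) w)"
    unfolding two_level_def Let_def c_def[symmetric] s_def[symmetric]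
  proof (intro conjI)
    show "comp (mat_adjoint U *\<^sub>v w) v \<in> carrier_vec n" "comp (U *\<^sub>v v) w \<in> carrier_vec n"
      using comp car v w by auto
    show "P *\<^sub>v comp (mat_adjoint U *\<^sub>v w) v = 0\<^sub>v n"
      using lin[OF p(1) car(2) v(1)] Uw zero[OF v(1)] v(2) by (simp add: c_def)
    show "Pt *\<^sub>v comp (U *\<^sub>v v) w = 0\<^sub>v n"
      using lin[OF q(1) car(1) w(1)] Uv zero[OF w(1)] w(2) by (simp add: c_def)
    show "U *\<^sub>v v = c \<cdot>\<^sub>v w + s \<cdot>\<^sub>v comp (U *\<^sub>v v) w" by (rule dec[OF car(1) w(1)])
    show "mat_adjoint U *\<^sub>v w = c \<cdot>\<^sub>v v + s \<cdot>\<^sub>v comp (mat_adjoint U *\<^sub>v w) v" by (rule dec[OF car(2) v(1)])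
    show "U *\<^sub>v comp (mat_adjoint U *\<^sub>v w) v = s \<cdot>\<^sub>v w - c \<cdot>\<^sub>v comp (U *\<^sub>v v) w"
      using lin[OF U(1) car(2) v(1)] U(3)[OF w(1)] swap[OF car(1) w(1)] by simp
    show "mat_adjoint U *\<^sub>v comp (U *\<^sub>v v) w = s \<cdot>\<^sub>v v - c \<cdot>\<^sub>v comp (mat_adjoint U *\<^sub>v w) v"
      using lin[OF U' car(1) w(1)] U(2)[OF v(1)] swap[OF car(2) v(1)] by simp
  qed (use v w in auto)
  then show ?thesis by blast
qed

text \<open>A vector with \<open>Pt U v = 0\<close> fits the same pattern with \<open>w = v' = 0\<close>.\<close>

lemma two_level_of_kernel:
  assumes unit: "unitary_mat n U" and P: "orth_proj n P" and Pt: "orth_proj n Pt"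
    and v: "v \<in> carrier_vec n" "P *\<^sub>v v = v" and Uv: "Pt *\<^sub>v (U *\<^sub>v v) = 0\<^sub>v n"
  shows "two_level n U P Pt 0 v (0\<^sub>v n) (0\<^sub>v n) (U *\<^sub>v v)"
proof -
  note U = unitary_matD[OF unit]
  note U' = mat_adjoint_carrier[OF U(1)]
  have z: "A *\<^sub>v 0\<^sub>v n = 0\<^sub>v n" if "A \<in> carrier_mat n n" for A :: "complex mat"
    using that by (intro eq_vecI) auto
  have "U *\<^sub>v v \<in> carrier_vec n" using U(1) v by simp
  moreover have "0 \<cdot>\<^sub>v y = 0\<^sub>v n" if "y \<in> carrier_vec n" for y :: "complex vec"
    using that by (intro eq_vecI) auto
  moreover have "y - 0\<^sub>v n = y" "0\<^sub>v n + y = y" if "y \<in> carrier_vec n" for y :: "complex vec"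
    using that by (intro eq_vecI; auto)+
  moreover have "1 \<cdot>\<^sub>v 0\<^sub>v n = (0\<^sub>v n :: complex vec)" by (intro eq_vecI) auto
  ultimately show ?thesis
    using assms orth_projD[OF P] orth_projD[OF Pt] U U' z by (simp add: two_level_def)
qed

section \<open>The controlled circuit\<close>

text \<open>The index arithmetic of \<open>kron\<close>: \<open>k\<close> encodes the pair
  \<open>(k div b, k mod b)\<close>.\<close>

lemma sum_div_mod:
  fixes f :: "nat \<Rightarrow> nat \<Rightarrow> 'a::comm_monoid_add"
  shows "(\<Sum>k<a * b. f (k div b) (k mod b)) = (\<Sum>i<a. \<Sum>j<b. f i j)"
proof -
  have "(\<Sum>k<a * b. f (k div b) (k mod b)) = (\<Sum>i<a. \<Sum>k = i * b..<i * b + b. f (k div b) (k mod b))"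
    by (rule sum.nat_group[symmetric])
  also have "\<dots> = (\<Sum>i<a. \<Sum>j<b. f i j)"
  proof (rule sum.cong[OF refl])
    fix i
    have "(\<Sum>k = i * b..<i * b + b. f (k div b) (k mod b)) = (\<Sum>j = 0..<b. f ((j + i * b) div b) ((j + i * b) mod b))"
      using sum.shift_bounds_nat_ivl[of "\<lambda>k. f (k div b) (k mod b)" 0 "i * b" b] by (simp add: add.commute)
    also have "\<dots> = (\<Sum>j<b. f i j)" unfolding lessThan_atLeast0 by (rule sum.cong) auto
    finally show "(\<Sum>k = i * b..<i * b + b. f (k div b) (k mod b)) = (\<Sum>j<b. f i j)" .
  qed
  finally show ?thesis .
qed

lemma kron_mult:
  assumes A: "A \<in> carrier_mat ra ka" and C: "C \<in> carrier_mat ka ca"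
    and B: "B \<in> carrier_mat rb kb" and D: "D \<in> carrier_mat kb cb"
  shows "kron A B * kron C D = kron (A * C) (B * D)"
proof (rule eq_matI)
  fix i j assume "i < dim_row (kron (A * C) (B * D))" "j < dim_col (kron (A * C) (B * D))"
  then have ij: "i < ra * rb" "j < ca * cb" using assms by (auto simp: kron_def)
  then have pos: "rb > 0" "cb > 0" by (auto intro: Nat.gr0I)
  have lt: "i div rb < ra" "i mod rb < rb" "j div cb < ca" "j mod cb < cb"
    using ij pos by (auto simp: less_mult_imp_div_less)
  have "(kron A B * kron C D) $$ (i, j) = (\<Sum>k<ka * kb.
      A $$ (i div rb, k div kb) * B $$ (i mod rb, k mod kb) * (C $$ (k div kb, j div cb) * D $$ (k mod kb, j mod cb)))"
    using assms ij by (auto simp: scalar_prod_def kron_def lessThan_atLeast0 intro!: sum.cong)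
  also have "\<dots> = (\<Sum>k<ka. \<Sum>l<kb. A $$ (i div rb, k) * B $$ (i mod rb, l) * (C $$ (k, j div cb) * D $$ (l, j mod cb)))"
    by (rule sum_div_mod)
  also have "\<dots> = (\<Sum>k<ka. A $$ (i div rb, k) * C $$ (k, j div cb)) * (\<Sum>l<kb. B $$ (i mod rb, l) * D $$ (l, j mod cb))"
    unfolding sum_product by (intro sum.cong refl) (simp add: mult_ac)
  also have "\<dots> = kron (A * C) (B * D) $$ (i, j)"
    using assms ij lt by (auto simp: scalar_prod_def kron_def lessThan_atLeast0 intro!: arg_cong2[of _ _ _ _ times] sum.cong)
  finally show "(kron A B * kron C D) $$ (i, j) = kron (A * C) (B * D) $$ (i, j)" .
qed (use assms in \<open>auto simp: kron_def\<close>)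

lemma kron_carrier:
  assumes "A \<in> carrier_mat ra ca" "B \<in> carrier_mat rb cb"
  shows "kron A B \<in> carrier_mat (ra * rb) (ca * cb)"
  using assms by (auto simp: kron_def)

lemma kron_scalar:
  assumes "B \<in> carrier_mat r c"
  shows "kron (mat 1 1 (\<lambda>_. a)) B = a \<cdot>\<^sub>m B"
  using assms by (intro eq_matI) (auto simp: kron_def)

lemma ket_carrier: "ket0 \<in> carrier_mat 2 1" "ket1 \<in> carrier_mat 2 1" "ket_plus \<in> carrier_mat 2 1"
  by (auto simp: ket0_def ket1_def ket_plus_def mat_of_cols_list_def)

text \<open>Each basis state has squared overlap 1/2 with the plus state; the result is a 1 x 1
  matrix, ready for \<open>kron_scalar\<close>.\<close>

lemma plus_ket_bra_plus:
  assumes "k = ket0 \<or> k = ket1"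
  shows "mat_adjoint ket_plus * (k * mat_adjoint k) * ket_plus = mat 1 1 (\<lambda>_. 1 / 2)"
proof (rule eq_matI)
  have k: "k \<in> carrier_mat 2 1" using assms ket_carrier by auto
  note d = carrier_matD[OF k] carrier_matD[OF ket_carrier(3)]
  fix i j assume "i < dim_row (mat 1 1 (\<lambda>_. 1 / 2 :: complex))" "j < dim_col (mat 1 1 (\<lambda>_. 1 / 2 :: complex))"
  then have ij: "i = 0" "j = 0" by auto
  have two: "complex_of_real (sqrt 2) * complex_of_real (sqrt 2) = 2"
    by (simp flip: of_real_mult)
  have p: "ket_plus $$ (0, 0) = 1 / complex_of_real (sqrt 2)" "ket_plus $$ (1, 0) = 1 / complex_of_real (sqrt 2)"
    by (auto simp: ket_plus_def mat_of_cols_list_def)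
  have kk: "k $$ (0, 0) * cnj (k $$ (0, 0)) + k $$ (1, 0) * cnj (k $$ (1, 0)) = 1"
    "k $$ (0, 0) * cnj (k $$ (1, 0)) = 0" "k $$ (1, 0) * cnj (k $$ (0, 0)) = 0"
    using assms by (auto simp: ket0_def ket1_def mat_of_cols_list_def)
  have u: "{0..<2} = {0, 1::nat}" by auto
  have "(mat_adjoint ket_plus * (k * mat_adjoint k) * ket_plus) $$ (0, 0) =
    (k $$ (0, 0) * cnj (k $$ (0, 0)) + k $$ (1, 0) * cnj (k $$ (1, 0)) + k $$ (0, 0) * cnj (k $$ (1, 0))
     + k $$ (1, 0) * cnj (k $$ (0, 0))) / (complex_of_real (sqrt 2) * complex_of_real (sqrt 2))"
    using d by (simp add: scalar_prod_def u p[simplified]) (simp add: field_simps)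
  also have "\<dots> = 1 / 2" by (simp only: kk two) simp
  finally show "(mat_adjoint ket_plus * (k * mat_adjoint k) * ket_plus) $$ (i, j) = mat 1 1 (\<lambda>_. 1 / 2) $$ (i, j)"
    by (simp add: ij)
qed (use ket_carrier in auto)

text \<open>On each branch the mixed product rule \<open>kron_mult\<close> collapses the qubit to
  the scalar 1/2, so the controlled operation becomes the average of its branches.\<close>

lemma controlled_average:
  assumes A: "A \<in> carrier_mat n n" and B: "B \<in> carrier_mat n n" and C: "C \<in> carrier_mat n n"
    and D: "D \<in> carrier_mat n n"
  shows "kron (mat_adjoint ket_plus) A *
      (kron (ket0 * mat_adjoint ket0) B + kron (ket1 * mat_adjoint ket1) C) * kron ket_plus D
    = A * ((1 / 2) \<cdot>\<^sub>m (B + C)) * D"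
proof -
  note k = ket_carrier and k' = ket_carrier[THEN mat_adjoint_carrier]
  have kk: "ket0 * mat_adjoint ket0 \<in> carrier_mat 2 2" "ket1 * mat_adjoint ket1 \<in> carrier_mat 2 2"
    using k k' by (auto intro!: mult_carrier_mat)
  have part: "kron (mat_adjoint ket_plus) A * kron (q * mat_adjoint q) X * kron ket_plus D = (1 / 2) \<cdot>\<^sub>m (A * X * D)"
    if q: "q = ket0 \<or> q = ket1" and X: "X \<in> carrier_mat n n" for q X
  proof -
    have qq: "q * mat_adjoint q \<in> carrier_mat 2 2" using q kk by auto
    have "kron (mat_adjoint ket_plus) A * kron (q * mat_adjoint q) X * kron ket_plus D
      = kron (mat_adjoint ket_plus * (q * mat_adjoint q) * ket_plus) (A * X * D)"
      unfolding kron_mult[OF k'(3) qq A X]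
      by (rule kron_mult[OF mult_carrier_mat[OF k'(3) qq] k(3) mult_carrier_mat[OF A X] D])
    also have "\<dots> = (1 / 2) \<cdot>\<^sub>m (A * X * D)"
      unfolding plus_ket_bra_plus[OF q] using A X D by (intro kron_scalar[of _ n n]) (auto intro!: mult_carrier_mat)
    finally show ?thesis .
  qed
  note K1 = kron_carrier[OF k'(3) A] and K2 = kron_carrier[OF kk(1) B] and K3 = kron_carrier[OF kk(2) C]
    and K4 = kron_carrier[OF k(3) D]
  have "kron (mat_adjoint ket_plus) A *
      (kron (ket0 * mat_adjoint ket0) B + kron (ket1 * mat_adjoint ket1) C) * kron ket_plus D
    = (1 / 2) \<cdot>\<^sub>m (A * B * D) + (1 / 2) \<cdot>\<^sub>m (A * C * D)"
    unfolding mult_add_distrib_mat[OF K1 K2 K3]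
      add_mult_distrib_mat[OF mult_carrier_mat[OF K1 K2] mult_carrier_mat[OF K1 K3] K4]
    using part[of ket0 B] part[of ket1 C] B C by simp
  also have "\<dots> = (1 / 2) \<cdot>\<^sub>m (A * B * D + A * C * D)"
    using A B C D by (intro add_smult_distrib_left_mat[symmetric]) (auto intro!: mult_carrier_mat)
  also have "A * B * D + A * C * D = A * (B + C) * D"
    by (simp only: mult_add_distrib_mat[OF A B C]
      add_mult_distrib_mat[OF mult_carrier_mat[OF A B] mult_carrier_mat[OF A C] D])
  also have "(1 / 2) \<cdot>\<^sub>m (A * (B + C) * D) = A * ((1 / 2) \<cdot>\<^sub>m (B + C)) * D"
  proof -
    have BC: "B + C \<in> carrier_mat n n" using B C by simp
    show ?thesis
      by (simp only: mult_smult_distrib[OF A BC] mult_smult_assoc_mat[OF mult_carrier_mat[OF A BC] D])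
  qed
  finally show ?thesis .
qed

section \<open>Singular vectors in the circuit\<close>

lemma onb_of_img_fixed:
  assumes P: "orth_proj n P" and f: "onb_of_img n P f k" and j: "j < k"
  shows "f j \<in> carrier_vec n" "P *\<^sub>v f j = f j"
proof -
  show fj: "f j \<in> carrier_vec n" using f j by (simp add: onb_of_img_def orthonormal_family_def)
  have "f j = comb_vec n (\<lambda>i. if i = j then 1 else 0) f {..<k}"
    using comb_vec_delta[of "{..<k}" j f n 1] fj j by simp
  then have "f j \<in> mat_img n P"
    using f unfolding onb_of_img_def lin_span_comb_vec by (metis rangeI)
  then show "P *\<^sub>v f j = f j" by (rule orth_proj_mult_vec_img[OF P])
qed

lemma mat_adjoint_mat_sum_ket_bra:
  assumes "\<And>i. i \<in> I \<Longrightarrow> f i \<in> carrier_vec n" "\<And>i. i \<in> I \<Longrightarrow> g i \<in> carrier_vec n"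
  shows "mat_adjoint (mat_sum n (\<lambda>i. complex_of_real (c i) \<cdot>\<^sub>m ket_bra (f i) (g i)) I) =
    mat_sum n (\<lambda>i. complex_of_real (c i) \<cdot>\<^sub>m ket_bra (g i) (f i)) I"
    (is "mat_adjoint ?L = ?R")
proof (rule eq_matI)
  fix a b assume "a < dim_row ?R" "b < dim_col ?R"
  then have ab: "a < n" "b < n" by (auto simp: mat_sum_def)
  then have "mat_adjoint ?L $$ (a, b) = cnj (?L $$ (b, a))"
    by (subst index_mat_adjoint) (auto simp: mat_sum_def)
  also have "\<dots> = ?R $$ (a, b)"
    using ab by (auto simp: mat_sum_def ket_bra_def carrier_vecD[OF assms(1)] carrier_vecD[OF assms(2)]
        mult.commute intro!: sum.cong)
  finally show "mat_adjoint ?L $$ (a, b) = ?R $$ (a, b)" .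
qed (auto simp: mat_sum_def)

text \<open>\<open>P\<close> fixes \<open>v j\<close> and so can be inserted to apply the
  decomposition; its adjoint handles \<open>w j\<close>. For \<open>min d dt \<le> j < d\<close> no
  term of the sum survives.\<close>

lemma singular_vectors:
  assumes unit: "unitary_mat n U" and P: "orth_proj n P" and Pt: "orth_proj n Pt"
    and v: "onb_of_img n P v d" and w: "onb_of_img n Pt w dt"
    and svd: "Pt * U * P = mat_sum n (\<lambda>i. complex_of_real (\<sigma> i) \<cdot>\<^sub>m ket_bra (w i) (v i)) {..<min d dt}"
  shows "j < d \<Longrightarrow> Pt *\<^sub>v (U *\<^sub>v v j) = (if j < min d dt then complex_of_real (\<sigma> j) \<cdot>\<^sub>v w j else 0\<^sub>v n)"
    and "j < min d dt \<Longrightarrow> P *\<^sub>v (mat_adjoint U *\<^sub>v w j) = complex_of_real (\<sigma> j) \<cdot>\<^sub>v v j"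
proof -
  note U = unitary_matD(1)[OF unit]
  note U' = mat_adjoint_carrier[OF U]
  note p = orth_projD[OF P] and q = orth_projD[OF Pt]
  note fv = onb_of_img_fixed[OF P v] and fw = onb_of_img_fixed[OF Pt w]
  have compose: "A * B * C *\<^sub>v x = A *\<^sub>v (B *\<^sub>v (C *\<^sub>v x))"
    if "A \<in> carrier_mat n n" "B \<in> carrier_mat n n" "C \<in> carrier_mat n n" "x \<in> carrier_vec n" for A B C :: "complex mat" and x
    using that assoc_mult_mat_vec[of "A * B" n n C n x] assoc_mult_mat_vec[of A n n B n "C *\<^sub>v x"]
    by (simp add: mult_carrier_mat[of A n n B n])
  have act: "mat_sum n (\<lambda>i. complex_of_real (\<sigma> i) \<cdot>\<^sub>m ket_bra (f i) (g i)) {..<min d dt} *\<^sub>v g j =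
      (if j < min d dt then complex_of_real (\<sigma> j) \<cdot>\<^sub>v f j else 0\<^sub>v n)"
    if f: "\<And>i. i < min d dt \<Longrightarrow> f i \<in> carrier_vec n" and g: "orthonormal_family n g k"
      and k: "min d dt \<le> k" "j < k" for f g k j
  proof -
    have "mat_sum n (\<lambda>i. complex_of_real (\<sigma> i) \<cdot>\<^sub>m ket_bra (f i) (g i)) {..<min d dt} *\<^sub>v g j
      = comb_vec n (\<lambda>i. complex_of_real (\<sigma> i) * (g j \<bullet>c g i)) f {..<min d dt}"
      using f g k by (intro mat_sum_ket_bra_mult_vec) (auto simp: orthonormal_family_def)
    also have "\<dots> = comb_vec n (\<lambda>i. if i = j then complex_of_real (\<sigma> j) else 0) f {..<min d dt}"
      using g k by (intro comb_vec_cong) (auto simp: orthonormal_family_def)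
    also have "\<dots> = (if j < min d dt then complex_of_real (\<sigma> j) \<cdot>\<^sub>v f j else 0\<^sub>v n)"
      using comb_vec_delta[of "{..<min d dt}" j f n "complex_of_real (\<sigma> j)"] f by simp
    finally show ?thesis .
  qed
  have on: "orthonormal_family n v d" "orthonormal_family n w dt"
    using v w by (auto simp: onb_of_img_def)
  show "Pt *\<^sub>v (U *\<^sub>v v j) = (if j < min d dt then complex_of_real (\<sigma> j) \<cdot>\<^sub>v w j else 0\<^sub>v n)" if j: "j < d"
  proof -
    have "Pt *\<^sub>v (U *\<^sub>v v j) = Pt * U * P *\<^sub>v v j"
      using compose[OF q(1) U p(1) fv(1)[OF j]] fv(2)[OF j] by simp
    also have "\<dots> = (if j < min d dt then complex_of_real (\<sigma> j) \<cdot>\<^sub>v w j else 0\<^sub>v n)"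
      unfolding svd by (rule act[OF _ on(1) _ j]) (use fw in auto)
    finally show ?thesis .
  qed
  show "P *\<^sub>v (mat_adjoint U *\<^sub>v w j) = complex_of_real (\<sigma> j) \<cdot>\<^sub>v v j" if j: "j < min d dt"
  proof -
    have jt: "j < dt" using j by simp
    have "mat_adjoint (Pt * U * P) = P * (mat_adjoint U * Pt)"
      using mat_adjoint_mult[OF mult_carrier_mat[OF q(1) U] p(1)] mat_adjoint_mult[OF q(1) U]
      by (simp only: p q)
    also have "\<dots> = P * mat_adjoint U * Pt" by (rule assoc_mult_mat[OF p(1) U' q(1), symmetric])
    finally have adj: "P * mat_adjoint U * Pt =
        mat_sum n (\<lambda>i. complex_of_real (\<sigma> i) \<cdot>\<^sub>m ket_bra (v i) (w i)) {..<min d dt}"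
      unfolding svd using mat_adjoint_mat_sum_ket_bra[of "{..<min d dt}" w n v \<sigma>] fv(1) fw(1) by simp
    have "P *\<^sub>v (mat_adjoint U *\<^sub>v w j) = P * mat_adjoint U * Pt *\<^sub>v w j"
      using compose[OF p(1) U' q(1) fw(1)[OF jt]] fw(2)[OF jt] by simp
    also have "\<dots> = (if j < min d dt then complex_of_real (\<sigma> j) \<cdot>\<^sub>v v j else 0\<^sub>v n)"
      unfolding adj by (rule act[OF _ on(2) _ jt]) (use fv in auto)
    finally show ?thesis using j by simp
  qed
qed

text \<open>Negated phases conjugate both components of \<open>qsp\<close>, so averaging keeps the
  real parts.\<close>

lemma average_two_level:
  assumes P: "orth_proj n P" and Pt: "orth_proj n Pt" and U: "U \<in> carrier_mat n n"
    and t: "two_level n U P Pt x v v' w w'" and len: "odd (length \<Phi>)"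
  shows "((1 / 2) \<cdot>\<^sub>m (U_Phi n U P Pt \<Phi> + U_Phi n U P Pt (map uminus \<Phi>))) *\<^sub>v v =
    complex_of_real (Re (fst (qsp \<Phi> x))) \<cdot>\<^sub>v w + complex_of_real (Re (snd (qsp \<Phi> x))) \<cdot>\<^sub>v w'"
proof -
  let ?A = "U_Phi n U P Pt \<Phi>" and ?B = "U_Phi n U P Pt (map uminus \<Phi>)"
  have len': "odd (length (map uminus \<Phi>))" using len by simp
  have A: "?A \<in> carrier_mat n n" and B: "?B \<in> carrier_mat n n"
    using U_Phi_Cons_Cons(2)[OF P Pt U len] U_Phi_Cons_Cons(2)[OF P Pt U len'] by auto
  have v: "v \<in> carrier_vec n" and w: "w \<in> carrier_vec n" "w' \<in> carrier_vec n"
    using t by (auto simp: two_level_def)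
  have half: "(z + cnj z) / 2 = complex_of_real (Re z)" for z by (simp add: complex_add_cnj)
  have "((1 / 2) \<cdot>\<^sub>m (?A + ?B)) *\<^sub>v v = (1 / 2) \<cdot>\<^sub>v (?A *\<^sub>v v + ?B *\<^sub>v v)"
    using add_mult_distrib_mat_vec[OF A B v] A B v
    by (intro eq_vecI) (auto simp: scalar_prod_def sum_distrib_left sum.distrib algebra_simps)
  also have "\<dots> = (1 / 2) \<cdot>\<^sub>v ((fst (qsp \<Phi> x) \<cdot>\<^sub>v w + snd (qsp \<Phi> x) \<cdot>\<^sub>v w') +
      (cnj (fst (qsp \<Phi> x)) \<cdot>\<^sub>v w + cnj (snd (qsp \<Phi> x)) \<cdot>\<^sub>v w'))"
    by (simp add: U_Phi_two_level[OF P Pt U t len] U_Phi_two_level[OF P Pt U t len'] qsp_uminus)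
  also have "\<dots> = ((fst (qsp \<Phi> x) + cnj (fst (qsp \<Phi> x))) / 2) \<cdot>\<^sub>v w
      + ((snd (qsp \<Phi> x) + cnj (snd (qsp \<Phi> x))) / 2) \<cdot>\<^sub>v w'"
    using w by (intro eq_vecI) (auto simp: algebra_simps add_divide_distrib)
  finally show ?thesis by (simp only: half)
qed

text \<open>By linearity it suffices to follow each \<open>v i\<close>. The bound
  \<open>t < 1\<close> puts the selected singular values below 1, so that each pair gives a block,
  and the left projector removes the part along \<open>w'\<close>.\<close>

lemma singular_value_transformation:
  assumes unit: "unitary_mat n U" and P: "orth_proj n P" and Pt: "orth_proj n Pt"
    and v: "onb_of_img n P v d" and w: "onb_of_img n Pt w dt"
    and pos: "\<forall>i < min d dt. \<sigma> i \<ge> 0" and zero: "\<forall>i \<ge> min d dt. \<sigma> i = 0"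
    and svd: "Pt * U * P = mat_sum n (\<lambda>i. complex_of_real (\<sigma> i) \<cdot>\<^sub>m ket_bra (w i) (v i)) {..<min d dt}"
    and t: "t < 1" and len: "odd (length \<Phi>)"
  shows "kron (mat_adjoint ket_plus) (proj_onto n (lin_span n w {i. i < dt \<and> \<sigma> i \<le> t})) *
      (kron (ket0 * mat_adjoint ket0) (U_Phi n U P Pt \<Phi>) +
       kron (ket1 * mat_adjoint ket1) (U_Phi n U P Pt (map uminus \<Phi>))) *
      kron ket_plus (proj_onto n (lin_span n v {i. i < d \<and> \<sigma> i \<le> t}))
    = mat_sum n (\<lambda>i. complex_of_real (Re (fst (qsp \<Phi> (\<sigma> i)))) \<cdot>\<^sub>m ket_bra (w i) (v i))
        {i. i < min d dt \<and> \<sigma> i \<le> t}"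
proof -
  define I where "I = {i. i < d \<and> \<sigma> i \<le> t}"
  define It where "It = {i. i < dt \<and> \<sigma> i \<le> t}"
  define J where "J = {i. i < min d dt \<and> \<sigma> i \<le> t}"
  define c where "c i = complex_of_real (Re (fst (qsp \<Phi> (\<sigma> i))))" for i
  define M where "M = (1 / 2) \<cdot>\<^sub>m (U_Phi n U P Pt \<Phi> + U_Phi n U P Pt (map uminus \<Phi>))"
  let ?Q = "span_proj n w It"
  note U = unitary_matD(1)[OF unit]
  note q = orth_projD[OF Pt]
  note fv = onb_of_img_fixed[OF P v] and fw = onb_of_img_fixed[OF Pt w]
  note sv = singular_vectors[OF unit P Pt v w svd]
  have on: "orthonormal_family n v d" "orthonormal_family n w dt"
    using v w by (auto simp: onb_of_img_def)
  have I: "I \<subseteq> {..<d}" and It: "It \<subseteq> {..<dt}" by (auto simp: I_def It_def)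
  note proj_v = proj_onto_lin_span[OF on(1) I] and proj_w = proj_onto_lin_span[OF on(2) It]
  have len': "odd (length (map uminus \<Phi>))" using len by simp
  have UA: "U_Phi n U P Pt \<Phi> \<in> carrier_mat n n" and UB: "U_Phi n U P Pt (map uminus \<Phi>) \<in> carrier_mat n n"
    using U_Phi_Cons_Cons(2)[OF P Pt U len] U_Phi_Cons_Cons(2)[OF P Pt U len'] by auto
  have M: "M \<in> carrier_mat n n" unfolding M_def using UA UB by simp
  \<comment> \<open>The vectors \<open>w i\<close> lie in the image of the self-adjoint
    \<open>Pt\<close>, so they are orthogonal to its kernel.\<close>
  have kill: "?Q *\<^sub>v y = 0\<^sub>v n" if y: "y \<in> carrier_vec n" "Pt *\<^sub>v y = 0\<^sub>v n" for y
  proof -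
    have "y \<bullet>c w i = 0" if "i \<in> It" for i
    proof -
      have i: "i < dt" using that by (simp add: It_def)
      have "y \<bullet>c w i = y \<bullet>c (mat_adjoint Pt *\<^sub>v w i)" using fw(2)[OF i] q(3) by simp
      also have "\<dots> = (Pt *\<^sub>v y) \<bullet>c w i" by (rule cscalar_prod_mult_mat[OF q(1) y(1) fw(1)[OF i], symmetric])
      finally show ?thesis using y fw(1)[OF i] by simp
    qed
    then have "?Q *\<^sub>v y = comb_vec n (\<lambda>_. 0) w It" unfolding proj_w(2)[OF y(1)] by (intro comb_vec_cong)
    then show ?thesis by (auto simp: comb_vec_def)
  qed
  have two: "?Q * M *\<^sub>v v i = c i \<cdot>\<^sub>v (?Q *\<^sub>v y)"
    if "i < d" and tl: "two_level n U P Pt (\<sigma> i) (v i) v' y y'" for i v' y y'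
  proof -
    have y: "y \<in> carrier_vec n" "y' \<in> carrier_vec n" "Pt *\<^sub>v y' = 0\<^sub>v n"
      using tl by (auto simp: two_level_def)
    have "?Q * M *\<^sub>v v i = ?Q *\<^sub>v (M *\<^sub>v v i)"
      by (rule assoc_mult_mat_vec[OF span_proj_carrier M fv(1)[OF \<open>i < d\<close>]])
    also have "M *\<^sub>v v i = c i \<cdot>\<^sub>v y + complex_of_real (Re (snd (qsp \<Phi> (\<sigma> i)))) \<cdot>\<^sub>v y'"
      unfolding M_def c_def by (rule average_two_level[OF P Pt U tl len])
    also have "?Q *\<^sub>v \<dots> = c i \<cdot>\<^sub>v (?Q *\<^sub>v y) + complex_of_real (Re (snd (qsp \<Phi> (\<sigma> i)))) \<cdot>\<^sub>v (?Q *\<^sub>v y')"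
      using y by (simp add: mult_add_distrib_mat_vec[of _ n n] mult_mat_vec[of _ n n])
    also have "\<dots> = c i \<cdot>\<^sub>v (?Q *\<^sub>v y)"
      unfolding kill[OF y(2,3)] using y carrier_matD[OF span_proj_carrier[of n w It]] by (intro eq_vecI) auto
    finally show ?thesis .
  qed
  have actJ: "?Q * M *\<^sub>v v i = c i \<cdot>\<^sub>v w i" if i: "i \<in> J" for i
  proof -
    have i': "i < d" "i < dt" "i < min d dt" "i \<in> It" "0 \<le> \<sigma> i" "\<sigma> i < 1"
      using i t pos by (auto simp: J_def It_def)
    have "Pt *\<^sub>v (U *\<^sub>v v i) = complex_of_real (\<sigma> i) \<cdot>\<^sub>v w i" using sv(1)[OF i'(1)] i'(3) by simp
    then obtain v' w' where "two_level n U P Pt (\<sigma> i) (v i) v' (w i) w'"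
      using two_level_of_singular_pair[OF unit P Pt fv[OF i'(1)] fw[OF i'(2)] i'(5,6) _ sv(2)[OF i'(3)]] by blast
    then show ?thesis using two[OF i'(1)] proj_w(3)[OF i'(4)] by simp
  qed
  \<comment> \<open>Indices with \<open>min d dt \<le> i < d\<close> have no left partner;
    \<open>two_level_of_kernel\<close> puts the zero vector in its place, so their terms
    disappear.\<close>
  have act0: "?Q * M *\<^sub>v v i = 0\<^sub>v n" if i: "i \<in> I - J" for i
  proof -
    have i': "i < d" "\<not> i < min d dt" using i by (auto simp: I_def J_def)
    then have s0: "\<sigma> i = 0" using zero by simp
    have "Pt *\<^sub>v (U *\<^sub>v v i) = 0\<^sub>v n" using sv(1)[OF i'(1)] by (simp only: i'(2) if_False)
    then have "two_level n U P Pt (\<sigma> i) (v i) (0\<^sub>v n) (0\<^sub>v n) (U *\<^sub>v v i)"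
      unfolding s0 by (rule two_level_of_kernel[OF unit P Pt fv[OF i'(1)]])
    then have "?Q * M *\<^sub>v v i = c i \<cdot>\<^sub>v (?Q *\<^sub>v 0\<^sub>v n)" by (rule two[OF i'(1)])
    also have "?Q *\<^sub>v 0\<^sub>v n = 0\<^sub>v n"
      using carrier_matD[OF span_proj_carrier[of n w It]] by (intro eq_vecI) auto
    finally show ?thesis by (auto simp: eq_vecI)
  qed
  have JI: "J \<subseteq> I" by (auto simp: I_def J_def)
  have finI: "finite I" by (simp add: I_def)
  have "kron (mat_adjoint ket_plus) ?Q *
      (kron (ket0 * mat_adjoint ket0) (U_Phi n U P Pt \<Phi>) +
       kron (ket1 * mat_adjoint ket1) (U_Phi n U P Pt (map uminus \<Phi>))) *
      kron ket_plus (span_proj n v I) = ?Q * M * span_proj n v I"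
    unfolding M_def by (rule controlled_average[OF span_proj_carrier UA UB span_proj_carrier])
  also have "\<dots> = mat_sum n (\<lambda>i. ket_bra (?Q * M *\<^sub>v v i) (v i)) I"
    by (rule mult_span_proj) (use M fv(1) in \<open>auto simp: I_def intro: mult_carrier_mat[OF span_proj_carrier]\<close>)
  also have "\<dots> = mat_sum n (\<lambda>i. c i \<cdot>\<^sub>m ket_bra (w i) (v i)) J"
  proof (rule eq_matI)
    fix a b assume "a < dim_row (mat_sum n (\<lambda>i. c i \<cdot>\<^sub>m ket_bra (w i) (v i)) J)"
      "b < dim_col (mat_sum n (\<lambda>i. c i \<cdot>\<^sub>m ket_bra (w i) (v i)) J)"
    then have ab: "a < n" "b < n" by (auto simp: mat_sum_def)
    have "(\<Sum>i\<in>I. ket_bra (?Q * M *\<^sub>v v i) (v i) $$ (a, b)) = (\<Sum>i\<in>J. (c i \<cdot>\<^sub>m ket_bra (w i) (v i)) $$ (a, b))"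
    proof (rule sum.mono_neutral_cong_right[OF finI JI])
      show "\<forall>i\<in>I - J. ket_bra (?Q * M *\<^sub>v v i) (v i) $$ (a, b) = 0"
      proof
        fix i assume i: "i \<in> I - J"
        then have "dim_vec (v i) = n" using fv(1)[of i] by (auto simp: I_def)
        then show "ket_bra (?Q * M *\<^sub>v v i) (v i) $$ (a, b) = 0"
          unfolding act0[OF i] using ab by (simp add: ket_bra_def)
      qed
    next
      fix i assume i: "i \<in> J"
      then have "dim_vec (v i) = n" "dim_vec (w i) = n" using fv(1)[of i] fw(1)[of i] by (auto simp: J_def)
      then show "ket_bra (?Q * M *\<^sub>v v i) (v i) $$ (a, b) = (c i \<cdot>\<^sub>m ket_bra (w i) (v i)) $$ (a, b)"
        unfolding actJ[OF i] using ab by (simp add: ket_bra_def)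
    qed
    then show "mat_sum n (\<lambda>i. ket_bra (?Q * M *\<^sub>v v i) (v i)) I $$ (a, b) =
      mat_sum n (\<lambda>i. c i \<cdot>\<^sub>m ket_bra (w i) (v i)) J $$ (a, b)" using ab by (simp add: mat_sum_def)
  qed (auto simp: mat_sum_def)
  finally show ?thesis
    unfolding I_def[symmetric] It_def[symmetric] J_def[symmetric] proj_v(1) proj_w(1) c_def .
qed

text \<open>\<open>qsp_real_poly\<close> turns the polynomial of \<open>amplification_poly\<close>
  into phases, and \<open>singular_value_transformation\<close> transfers it to the
  matrices.\<close>

theorem mainTheorem15:
  "\<exists>C::real. C > 0 \<and>
    (\<forall>(n::nat) (U::complex mat) (P::complex mat) (Pt::complex mat)
        (\<gamma>::real) (\<delta>::real) (\<epsilon>::real)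
        (d::nat) (dt::nat) (v::nat \<Rightarrow> complex vec) (w::nat \<Rightarrow> complex vec) (\<sigma>::nat \<Rightarrow> real).
      unitary_mat n U \<longrightarrow> orth_proj n P \<longrightarrow> orth_proj n Pt \<longrightarrow>
      \<gamma> > 1 \<longrightarrow> 0 < \<delta> \<longrightarrow> \<delta> < 1/2 \<longrightarrow> 0 < \<epsilon> \<longrightarrow> \<epsilon> < 1/2 \<longrightarrow>
      onb_of_img n P v d \<longrightarrow> onb_of_img n Pt w dt \<longrightarrow>
      (\<forall>i < min d dt. \<sigma> i \<ge> 0) \<longrightarrow> (\<forall>i \<ge> min d dt. \<sigma> i = 0) \<longrightarrow>
      Pt * U * P = mat_sum n (\<lambda>i. complex_of_real (\<sigma> i) \<cdot>\<^sub>m ket_bra (w i) (v i)) {..<min d dt} \<longrightarrow>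
      (let t = (1 - \<delta>) / \<gamma>;
           P_t = proj_onto n (lin_span n v {i. i < d \<and> \<sigma> i \<le> t});
           Pt_t = proj_onto n (lin_span n w {i. i < dt \<and> \<sigma> i \<le> t})
       in \<exists>(m::nat) (\<Phi>::real list) (\<sigma>'::nat \<Rightarrow> real).
            odd m \<and> real m \<le> C * (\<gamma> / \<delta>) * ln (\<gamma> / \<epsilon>) \<and> length \<Phi> = m \<and>
            kron (mat_adjoint ket_plus) Pt_t *
              (kron (ket0 * mat_adjoint ket0) (U_Phi n U P Pt \<Phi>) +
               kron (ket1 * mat_adjoint ket1) (U_Phi n U P Pt (map uminus \<Phi>))) *
              kron ket_plus P_t
            = mat_sum n (\<lambda>i. complex_of_real (\<sigma>' i) \<cdot>\<^sub>m ket_bra (w i) (v i))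
                {i. i < min d dt \<and> \<sigma> i \<le> t} \<and>
            (\<forall>i < min d dt. \<sigma> i \<le> t \<longrightarrow>
               (\<sigma> i = 0 \<longrightarrow> \<sigma>' i = 0) \<and>
               (\<sigma> i > 0 \<longrightarrow> \<bar>\<sigma>' i / (\<gamma> * \<sigma> i) - 1\<bar> \<le> \<epsilon>))))"
proof (rule exI[of _ "651::real"], intro conjI allI impI)
  fix n :: nat and U P Pt :: "complex mat" and \<gamma> \<delta> \<epsilon> :: real and d dt :: nat
    and v w :: "nat \<Rightarrow> complex vec" and \<sigma> :: "nat \<Rightarrow> real"
  assume unit: "unitary_mat n U" and P: "orth_proj n P" and Pt: "orth_proj n Pt"
    and \<gamma>: "1 < \<gamma>" and \<delta>: "0 < \<delta>" "\<delta> < 1/2" and \<epsilon>: "0 < \<epsilon>" "\<epsilon> < 1/2"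
    and v: "onb_of_img n P v d" and w: "onb_of_img n Pt w dt"
    and pos: "\<forall>i < min d dt. \<sigma> i \<ge> 0" and zero: "\<forall>i \<ge> min d dt. \<sigma> i = 0"
    and svd: "Pt * U * P = mat_sum n (\<lambda>i. complex_of_real (\<sigma> i) \<cdot>\<^sub>m ket_bra (w i) (v i)) {..<min d dt}"
  define t where "t = (1 - \<delta>) / \<gamma>"
  have t: "0 < t" "t < 1" using \<gamma> \<delta> by (auto simp: t_def field_simps)
  obtain m p where m: "odd m" "real m \<le> 651 * (\<gamma> / \<delta>) * ln (\<gamma> / \<epsilon>)" and p: "graded m p"
    "\<And>x. \<bar>x\<bar> \<le> 1 \<Longrightarrow> \<bar>poly p x\<bar> < 1"
    "\<And>x. 0 < x \<Longrightarrow> x \<le> t \<Longrightarrow> \<bar>poly p x / (\<gamma> * x) - 1\<bar> \<le> \<epsilon>"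
    using amplification_poly[OF \<gamma> \<delta> \<epsilon>] unfolding t_def by metis
  \<comment> \<open>At \<open>x = t\<close> a relative error below 1/2 excludes the zero
    polynomial.\<close>
  have "p \<noteq> 0" using p(3)[of t] t \<epsilon> by auto
  then obtain \<Phi> where \<Phi>: "length \<Phi> = m" "\<And>x. \<bar>x\<bar> \<le> 1 \<Longrightarrow> Re (fst (qsp \<Phi> x)) = poly p x"
    using qsp_real_poly[OF m(1) p(1) _ p(2)] by blast
  \<comment> \<open>An odd polynomial has no constant term, so a zero singular value stays
    zero.\<close>
  have p0: "poly p 0 = 0" using gradedD[OF p(1), of 0] m(1) by (simp add: poly_0_coeff_0)
  define \<sigma>' where "\<sigma>' i = Re (fst (qsp \<Phi> (\<sigma> i)))" for i
  have \<sigma>': "\<sigma>' i = poly p (\<sigma> i)" if "i < min d dt" "\<sigma> i \<le> t" for i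
    unfolding \<sigma>'_def using that t pos by (intro \<Phi>) auto
  show "let t = (1 - \<delta>) / \<gamma>;
           P_t = proj_onto n (lin_span n v {i. i < d \<and> \<sigma> i \<le> t});
           Pt_t = proj_onto n (lin_span n w {i. i < dt \<and> \<sigma> i \<le> t})
       in \<exists>(m::nat) (\<Phi>::real list) (\<sigma>'::nat \<Rightarrow> real).
            odd m \<and> real m \<le> 651 * (\<gamma> / \<delta>) * ln (\<gamma> / \<epsilon>) \<and> length \<Phi> = m \<and>
            kron (mat_adjoint ket_plus) Pt_t *
              (kron (ket0 * mat_adjoint ket0) (U_Phi n U P Pt \<Phi>) +
               kron (ket1 * mat_adjoint ket1) (U_Phi n U P Pt (map uminus \<Phi>))) *
              kron ket_plus P_t
            = mat_sum n (\<lambda>i. complex_of_real (\<sigma>' i) \<cdot>\<^sub>m ket_bra (w i) (v i))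
                {i. i < min d dt \<and> \<sigma> i \<le> t} \<and>
            (\<forall>i < min d dt. \<sigma> i \<le> t \<longrightarrow>
               (\<sigma> i = 0 \<longrightarrow> \<sigma>' i = 0) \<and>
               (\<sigma> i > 0 \<longrightarrow> \<bar>\<sigma>' i / (\<gamma> * \<sigma> i) - 1\<bar> \<le> \<epsilon>))"
    unfolding Let_def t_def[symmetric]
  proof (rule exI[of _ m], rule exI[of _ \<Phi>], rule exI[of _ \<sigma>'], intro conjI allI impI)
    show "kron (mat_adjoint ket_plus) (proj_onto n (lin_span n w {i. i < dt \<and> \<sigma> i \<le> t})) *
        (kron (ket0 * mat_adjoint ket0) (U_Phi n U P Pt \<Phi>) +
         kron (ket1 * mat_adjoint ket1) (U_Phi n U P Pt (map uminus \<Phi>))) *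
        kron ket_plus (proj_onto n (lin_span n v {i. i < d \<and> \<sigma> i \<le> t}))
      = mat_sum n (\<lambda>i. complex_of_real (\<sigma>' i) \<cdot>\<^sub>m ket_bra (w i) (v i)) {i. i < min d dt \<and> \<sigma> i \<le> t}"
      unfolding \<sigma>'_def
      by (rule singular_value_transformation[OF unit P Pt v w pos zero svd t(2)]) (simp add: \<Phi> m)
  qed (use m \<Phi> \<sigma>' p(3) p0 in auto)
qed simp

end
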